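(* Let $X$ and $Y$ be complex Banach spaces. Suppose that $\mathcal{O}\subset X$ is open, $\mathcal{K}\subset \mathcal{O}$ is compact, $u:\mathcal{O}\to Y$ is holomorphic, and there is a constant $C<\infty$ such that $\sup_{a\in \mathcal{O}}\|u(a)\|_Y\le C$. Suppose that there exist $C_0,c_0,\alpha>0$ such that $$d_n(\mathcal{K})_X\le C_0\,\mathrm{e}^{-c_0n^\alpha},\qquad n\ge1.$$ Then there are constants $C_1,c_1>0$ such that $$d_n(u(\mathcal{K}))_Y\le C_1\,\mathrm{e}^{-c_1[\log(n+2)]^{\alpha+1}},\qquad n\ge1.$$
   Context: For a compact subset $\mathcal{A}$ of a Banach space $Z$ and an integer $n\ge 1$, the Kolmogorov $n$-width is $$d_n(\mathcal{A})_Z:=\inf_{\substack{V_n\subset Z\\ \dim V_n\le n}}\ \sup_{a\in\mathcal{A}}\ \inf_{v\in V_n}\|a-v\|_Z,$$ where $V_n$ ranges over linear subspaces of $Z$ of dimension at most $n$. For $m\ge1$, a continuous $m$-homogeneous polynomial $P:X\to Y$ is a continuous map of the form $P(x)=A(x,\ldots,x)$ for some $m$-linear map $A:X^m\to Y$. A mapping $u:\mathcal{O}\to Y$ on an open set $\mathcal{O}\subset X$ is holomorphic if for every $a\in\mathcal{O}$ there exist an open ball $B_X(a,r)\subset\mathcal{O}$ and continuous $m$-homogeneous polynomials $P_{a,m}:X\to Y$, $m\ge1$, such that $u(x)=u(a)+\sum_{m=1}^\infty P_{a,m}(x-a)$ uniformly for $x\in B_X(a,r)$ (equivalently, $u$ is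 complex Fréchet differentiable on $\mathcal{O}$). The constants $C_1,c_1$ are independent of $n$. *)

theory Defs
  imports "HOL-Analysis.Analysis"
begin

class complex_normed_vector = real_normed_vector +
  fixes scaleC :: "complex \<Rightarrow> 'a \<Rightarrow> 'a"  (infixr \<open>*\<^sub>C\<close> 75)
  assumes scaleC_add_right: "c *\<^sub>C (x + y) = c *\<^sub>C x + c *\<^sub>C y"
    and scaleC_add_left: "(c + d) *\<^sub>C x = c *\<^sub>C x + d *\<^sub>C x"
    and scaleC_scaleC: "c *\<^sub>C d *\<^sub>C x = (c * d) *\<^sub>C x"
    and scaleR_scaleC: "r *\<^sub>R x = complex_of_real r *\<^sub>C x"
    and norm_scaleC: "norm (c *\<^sub>C x) = cmod c * norm x"

class complex_banach = complex_normed_vector + banach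

instantiation complex :: complex_banach
begin

definition scaleC_complex :: "complex \<Rightarrow> complex \<Rightarrow> complex"
  where "scaleC_complex = (*)"

instance
  by standard (simp_all add: scaleC_complex_def algebra_simps scaleR_conv_of_real norm_mult)

end

lemma scaleC_one: "1 *\<^sub>C x = (x :: 'a :: complex_normed_vector)"
  using scaleR_scaleC[of 1 x] by simp

global_interpretation complex_vector:
  vector_space "scaleC :: complex \<Rightarrow> 'a \<Rightarrow> 'a :: complex_normed_vector"
  defines csubspace = complex_vector.subspace
    and cspan = complex_vector.span
    and cdependent = complex_vector.dependent
  by unfold_locales (simp_all add: scaleC_add_right scaleC_add_left scaleC_scaleC scaleC_one)

abbreviation clinear :: "('a :: complex_normed_vector \<Rightarrow> 'b :: complex_normed_vector) \<Rightarrow> bool"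
  where "clinear \<equiv> Vector_Spaces.linear scaleC scaleC"

text \<open>
  \<open>dim V \<le> n\<close> is expressed through a basis because the library's \<open>dim\<close> is \<open>0\<close> on
  infinite-dimensional spaces.
\<close>

definition cdim_le :: "'a :: complex_normed_vector set \<Rightarrow> nat \<Rightarrow> bool"
  where "cdim_le V n \<longleftrightarrow> (\<exists>B. finite B \<and> \<not> cdependent B \<and> cspan B = V \<and> card B \<le> n)"

text \<open>
  The value lies in \<open>[0, \<infinity>]\<close>, so that suprema always exist and the supremum over the empty
  set is \<open>0\<close>.
\<close>

definition kolmogorov_width :: "nat \<Rightarrow> 'a :: complex_normed_vector set \<Rightarrow> ennreal"
  where "kolmogorov_width n A =
    (INF V \<in> {V. csubspace V \<and> cdim_le V n}. SUP a\<in>A. INF v\<in>V. ennreal (norm (a - v)))"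

text \<open>
  An element of \<open>X\<^sup>m\<close> is a list of length \<open>m\<close>; the values of \<open>A\<close> on lists of other lengths
  are irrelevant.
\<close>

definition multilinear_map ::
    "nat \<Rightarrow> ('a :: complex_normed_vector list \<Rightarrow> 'b :: complex_normed_vector) \<Rightarrow> bool"
  where "multilinear_map m A \<longleftrightarrow>
    (\<forall>xs. length xs = m \<longrightarrow> (\<forall>i<m. clinear (\<lambda>x. A (xs[i := x]))))"

definition continuous_homogeneous_polynomial ::
    "nat \<Rightarrow> ('a :: complex_normed_vector \<Rightarrow> 'b :: complex_normed_vector) \<Rightarrow> bool"
  where "continuous_homogeneous_polynomial m P \<longleftrightarrow>
    continuous_on UNIV P \<and> (\<exists>A. multilinear_map m A \<and> (\<forall>x. P x = A (replicate m x)))"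

definition banach_holomorphic_on ::
    "('a :: complex_normed_vector \<Rightarrow> 'b :: complex_normed_vector) \<Rightarrow> 'a set \<Rightarrow> bool"
  where "banach_holomorphic_on u U \<longleftrightarrow>
    (\<forall>a\<in>U. \<exists>r>0. ball a r \<subseteq> U \<and>
      (\<exists>P. (\<forall>m\<ge>1. continuous_homogeneous_polynomial m (P m)) \<and>
        uniform_limit (ball a r) (\<lambda>N x. u a + (\<Sum>m=1..N. P m (x - a))) u sequentially))"

end

theory Submission imports Defs begin

text \<open>
  Put \<open>p = 1 / \<alpha>\<close>. Near a point \<open>x0\<close> of \<open>K\<close> write \<open>a - x0\<close> as a telescoping sum of pieces \<open>w k\<close>, where
  \<open>w k\<close> lies in a space of dimension \<open>O(2 ^ (k p))\<close> and has norm so small that the sum of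
  \<open>t ^ 2 ^ k w k\<close> stays in the ball of convergence of the Taylor series of \<open>u\<close> for \<open>\<bar>t\<bar> = 2\<close>. Evaluating
  a homogeneous Taylor polynomial along this curve gives a polynomial in \<open>t\<close>; by Cauchy's
  estimate its \<open>n\<close>-th coefficient is \<open>O(2 ^ -n)\<close>, so dropping the coefficients above \<open>L\<close> costs only
  \<open>O(2 ^ -L)\<close> at \<open>t = 1\<close>. The remaining coefficients lie in a space, independent of \<open>a\<close>, spanned by one
  vector for each multiset of basis vectors of total weight at most \<open>L\<close>, a basis vector of level
  \<open>k\<close> having weight \<open>2 ^ k\<close>. As for partitions into powers, there are \<open>exp (O(L ^ (1 / (\<alpha> + 1))))\<close> such
  multisets, which is the claimed rate.
\<close>

section \<open>Expansion of multilinear maps\<close>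

lemma multilinear_map_Cons:
  assumes "multilinear_map (Suc m) A"
  shows "multilinear_map m (\<lambda>xs. A (x # xs))"
  unfolding multilinear_map_def
proof (intro allI impI)
  fix xs :: "'a list" and i assume xs: "length xs = m" "i < m"
  then have "clinear (\<lambda>y. A ((x # xs)[Suc i := y]))"
    using assms unfolding multilinear_map_def by (metis Suc_less_eq length_Cons)
  then show "clinear (\<lambda>y. A (x # xs[i := y]))" by simp
qed

lemma multilinear_map_sum_Cons:
  assumes "multilinear_map (Suc m) A" "length xs = m"
  shows "A ((\<Sum>i\<in>I. c i *\<^sub>C x i) # xs) = (\<Sum>i\<in>I. c i *\<^sub>C A (x i # xs))"
proof -
  have "clinear (\<lambda>y. A ((0 # xs)[0 := y]))"
    using assms unfolding multilinear_map_def by (metis length_Cons zero_less_Suc)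
  then interpret l: Vector_Spaces.linear scaleC scaleC "\<lambda>y. A (y # xs)" by simp
  show ?thesis by (simp add: l.sum l.scale)
qed

text \<open>The first slot is expanded by linearity, the remaining \<open>m\<close> by induction.
  Since \<open>A\<close> need not be symmetric, the terms are indexed by words; the orderings of one
  multiset are collected only in \<open>weighted_sum_in_span\<close>.\<close>

lemma multilinear_map_replicate_sum:
  assumes "multilinear_map m A" "finite I"
  shows "A (replicate m (\<Sum>i\<in>I. c i *\<^sub>C x i)) =
    (\<Sum>\<kappa> | set \<kappa> \<subseteq> I \<and> length \<kappa> = m. prod_list (map c \<kappa>) *\<^sub>C A (map x \<kappa>))"
  using assms(1)
proof (induction m arbitrary: A)
  case 0
  have "{\<kappa>. set \<kappa> \<subseteq> I \<and> length \<kappa> = 0} = {[]}" by auto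
  then show ?case by (simp add: scaleC_one)
next
  case (Suc m)
  let ?S = "{\<kappa>. set \<kappa> \<subseteq> I \<and> length \<kappa> = m}"
  let ?s = "\<Sum>i\<in>I. c i *\<^sub>C x i"
  have "A (replicate (Suc m) ?s) = (\<Sum>i\<in>I. c i *\<^sub>C A (x i # replicate m ?s))"
    using multilinear_map_sum_Cons[OF Suc.prems, of "replicate m ?s"] by simp
  also have "\<dots> = (\<Sum>i\<in>I. c i *\<^sub>C (\<Sum>\<kappa>\<in>?S. prod_list (map c \<kappa>) *\<^sub>C A (x i # map x \<kappa>)))"
    by (simp add: Suc.IH[OF multilinear_map_Cons[OF Suc.prems]])
  also have "\<dots> = (\<Sum>(i, \<kappa>)\<in>I \<times> ?S. prod_list (map c (i # \<kappa>)) *\<^sub>C A (map x (i # \<kappa>)))"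
    by (simp add: complex_vector.scale_sum_right scaleC_scaleC sum.cartesian_product)
  also have "\<dots> = (\<Sum>\<kappa> | set \<kappa> \<subseteq> I \<and> length \<kappa> = Suc m. prod_list (map c \<kappa>) *\<^sub>C A (map x \<kappa>))"
    by (rule sum.reindex_bij_witness[of _ "\<lambda>\<kappa>. (hd \<kappa>, tl \<kappa>)" "\<lambda>(i, \<kappa>). i # \<kappa>"])
       (auto simp: length_Suc_conv)
  finally show ?case .
qed

text \<open>Over a one-point index set there is a single word of length \<open>m\<close>, and its
  coefficient is \<open>c ^ m\<close>.\<close>

lemma continuous_homogeneous_polynomial_scaleC:
  assumes "continuous_homogeneous_polynomial m P"
  shows "P (c *\<^sub>C x) = c ^ m *\<^sub>C P x"
proof -
  obtain A where A: "multilinear_map m A" "\<And>x. P x = A (replicate m x)"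
    using assms unfolding continuous_homogeneous_polynomial_def by auto
  have "{\<kappa> :: unit list. set \<kappa> \<subseteq> {()} \<and> length \<kappa> = m} = {replicate m ()}"
    by (auto simp: replicate_length_same[symmetric])
  then show ?thesis
    using multilinear_map_replicate_sum[OF A(1), of "{()}" "\<lambda>_. c" "\<lambda>_. x"] A(2)
    by (simp add: prod_list_replicate)
qed

section \<open>Cauchy estimates along weighted curves\<close>

text \<open>Discrete orthogonality, from a geometric sum with ratio
  \<open>\<omega> ^ l / \<omega> ^ n\<close>. It stands in for the contour integral in Cauchy's
  formula, so that finite sums suffice.\<close>

lemma sum_root_of_unity_powers:
  fixes l n N :: nat
  assumes "l \<le> N" "n \<le> N"
  defines "\<omega> \<equiv> cis (2 * pi / real (Suc N))"
  shows "(\<Sum>j\<le>N. (\<omega> ^ j) ^ l / (\<omega> ^ j) ^ n) = (if l = n then of_nat (Suc N) else 0)"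
proof (cases "l = n")
  case True
  have "\<omega> \<noteq> 0" by (simp add: \<omega>_def)
  then show ?thesis using True by simp
next
  case False
  define q where "q = \<omega> ^ l / \<omega> ^ n"
  have q: "q = cis (2 * pi * (real l - real n) / real (Suc N))"
    unfolding q_def \<omega>_def by (simp add: Complex.DeMoivre cis_divide field_simps del: of_nat_Suc)
  have "q ^ Suc N = cis (2 * pi * (real l - real n))"
    unfolding q Complex.DeMoivre by (simp del: power_Suc of_nat_Suc)
  also have "\<dots> = 1"
    using cis_multiple_2pi[of "real l - real n"] by (metis Ints_diff Ints_of_nat)
  finally have q1: "q ^ Suc N = 1" .
  \<comment> \<open>\<open>q = 1\<close> would make \<open>l - n\<close> a multiple of
    \<open>Suc N\<close>, impossible for distinct \<open>l\<close> and \<open>n\<close> that are at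
    most \<open>N\<close>.\<close>
  have "q \<noteq> 1"
  proof
    assume "q = 1"
    then have "cos (2 * pi * (real l - real n) / real (Suc N)) = 1"
      unfolding q by (metis cis.sel(1) one_complex.sel(1))
    then obtain k :: int where "2 * pi * (real l - real n) / real (Suc N) = real_of_int k * 2 * pi"
      using cos_one_2pi_int by blast
    then have "pi * (2 * (real l - real n)) = pi * (2 * (real_of_int k * real (Suc N)))"
      by (simp add: field_simps del: of_nat_Suc)
    then have "real l - real n = real_of_int k * real (Suc N)" by simp
    then have "int l - int n = k * int (Suc N)"
      by (metis of_int_diff of_int_eq_iff of_int_mult of_int_of_nat_eq)
    moreover have "\<bar>int l - int n\<bar> < int (Suc N)" using assms by auto
    ultimately show False using False
      by (smt (verit) mult_le_cancel_right1 mult_minus_left mult_zero_left of_nat_eq_iff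
          abs_mult mult_eq_0_iff zero_less_abs_iff)
  qed
  have "(\<Sum>j\<le>N. (\<omega> ^ j) ^ l / (\<omega> ^ j) ^ n) = (\<Sum>j\<le>N. q ^ j)"
    by (simp add: q_def power_divide power_mult[symmetric] mult.commute)
  also have "\<dots> = (\<Sum>j<Suc N. q ^ j)" by (simp add: lessThan_Suc_atMost)
  also have "\<dots> = 0" using geometric_sum[OF \<open>q \<noteq> 1\<close>, of "Suc N"] q1 by simp
  finally show ?thesis using False by simp
qed

text \<open>Cauchy's estimate by averaging over \<open>Suc N\<close> equally spaced points of the
  circle. As the degree is at most \<open>N\<close>, averaging against
  \<open>1 / (\<omega> ^ j) ^ n\<close> isolates \<open>R ^ n\<close> times \<open>T n\<close>
  exactly.\<close>

lemma norm_coeff_le_circle_bound: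
  fixes T :: "nat \<Rightarrow> 'a::complex_normed_vector"
  assumes bd: "\<And>t. cmod t = R \<Longrightarrow> norm (\<Sum>l\<le>N. t ^ l *\<^sub>C T l) \<le> G"
    and "R > 0" "n \<le> N"
  shows "R ^ n * norm (T n) \<le> G"
proof -
  define \<omega> where "\<omega> = cis (2 * pi / real (Suc N))"
  have w: "cmod \<omega> = 1" by (simp add: \<omega>_def)
  let ?g = "\<lambda>t. \<Sum>l\<le>N. t ^ l *\<^sub>C T l"
  let ?t = "\<lambda>j. complex_of_real R * \<omega> ^ j"
  have "(\<Sum>j\<le>N. (1 / (\<omega> ^ j) ^ n) *\<^sub>C ?g (?t j)) =
      (\<Sum>l\<le>N. \<Sum>j\<le>N. (of_real R ^ l * ((\<omega> ^ j) ^ l / (\<omega> ^ j) ^ n)) *\<^sub>C T l)"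
    unfolding complex_vector.scale_sum_right scaleC_scaleC
    by (subst sum.swap) (simp add: power_mult_distrib field_simps)
  also have "\<dots> = (\<Sum>l\<le>N. (of_real R ^ l * (\<Sum>j\<le>N. (\<omega> ^ j) ^ l / (\<omega> ^ j) ^ n)) *\<^sub>C T l)"
    by (simp add: complex_vector.scale_sum_left sum_distrib_left)
  also have "\<dots> = (\<Sum>l\<le>N. if l = n then (of_real R ^ n * of_nat (Suc N)) *\<^sub>C T n else 0)"
    using \<open>n \<le> N\<close> unfolding \<omega>_def by (intro sum.cong refl) (simp add: sum_root_of_unity_powers del: of_nat_Suc)
  also have "\<dots> = (of_real R ^ n * of_nat (Suc N)) *\<^sub>C T n"
    using \<open>n \<le> N\<close> by (simp add: sum.delta)
  finally have eq: "(\<Sum>j\<le>N. (1 / (\<omega> ^ j) ^ n) *\<^sub>C ?g (?t j)) = (of_real R ^ n * of_nat (Suc N)) *\<^sub>C T n" .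
  have "R ^ n * real (Suc N) * norm (T n) = norm (\<Sum>j\<le>N. (1 / (\<omega> ^ j) ^ n) *\<^sub>C ?g (?t j))"
    unfolding eq norm_scaleC using \<open>R > 0\<close>
    by (simp only: norm_mult norm_power norm_of_real norm_of_nat abs_of_pos)
  also have "\<dots> \<le> (\<Sum>j\<le>N. norm (?g (?t j)))"
    by (rule order_trans[OF norm_sum]) (simp add: norm_scaleC norm_divide norm_power w del: sum.atMost_Suc)
  also have "\<dots> \<le> (\<Sum>j\<le>N. G)"
    using \<open>R > 0\<close> w by (intro sum_mono bd) (simp add: norm_mult norm_power)
  also have "\<dots> = real (Suc N) * G" by simp
  finally have "real (Suc N) * (R ^ n * norm (T n)) \<le> real (Suc N) * G" by (simp add: algebra_simps)
  then show ?thesis by (subst (asm) mult_le_cancel_left_pos) auto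
qed

text \<open>Scaling \<open>c i\<close> by \<open>t ^ wt i\<close> turns \<open>P\<close> into a
  polynomial in \<open>t\<close> whose coefficient \<open>T n\<close> gathers the words of weight
  \<open>n\<close>. The bound on the circle of radius 2 gives
  \<open>norm (T n) \<le> G / 2 ^ n\<close>, and the coefficients with \<open>n > L\<close> form a
  geometric tail.\<close>

lemma norm_weighted_tail_le:
  fixes P :: "'a::complex_normed_vector \<Rightarrow> 'b::complex_normed_vector"
    and wt :: "'i \<Rightarrow> nat"
  assumes A: "multilinear_map m A" "\<And>x. P x = A (replicate m x)"
    and "finite I"
    and bd: "\<And>t. cmod t = 2 \<Longrightarrow> norm (P (\<Sum>i\<in>I. (t ^ wt i * c i) *\<^sub>C x i)) \<le> G"
  shows "norm (P (\<Sum>i\<in>I. c i *\<^sub>C x i) -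
    (\<Sum>\<kappa> | set \<kappa> \<subseteq> I \<and> length \<kappa> = m \<and> sum_list (map wt \<kappa>) \<le> L. prod_list (map c \<kappa>) *\<^sub>C A (map x \<kappa>))) \<le> G / 2 ^ L"
proof -
  define S where "S = {\<kappa>. set \<kappa> \<subseteq> I \<and> length \<kappa> = m}"
  define W where "W \<kappa> = sum_list (map wt \<kappa>)" for \<kappa>
  have finS: "finite S" unfolding S_def using finite_lists_length_eq[OF \<open>finite I\<close>] by simp
  \<comment> \<open>\<open>N\<close> bounds the degree in \<open>t\<close>; inserting
    \<open>L\<close> gives \<open>L \<le> N\<close> and keeps \<open>Max\<close> meaningful when
    there are no words.\<close>
  define N where "N = Max (insert L (W ` S))"
  have N: "L \<le> N" "\<And>\<kappa>. \<kappa> \<in> S \<Longrightarrow> W \<kappa> \<le> N" unfolding N_def using finS by auto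
  define T where "T n = (\<Sum>\<kappa> | \<kappa> \<in> S \<and> W \<kappa> = n. prod_list (map c \<kappa>) *\<^sub>C A (map x \<kappa>))" for n
  have pw: "prod_list (map (\<lambda>i. t ^ wt i * c i) \<kappa>) = t ^ W \<kappa> * prod_list (map c \<kappa>)" for t :: complex and \<kappa>
    unfolding W_def by (induction \<kappa>) (auto simp: power_add mult_ac)
  have exp: "P (\<Sum>i\<in>I. (t ^ wt i * c i) *\<^sub>C x i) = (\<Sum>l\<le>N. t ^ l *\<^sub>C T l)" for t
  proof -
    have "P (\<Sum>i\<in>I. (t ^ wt i * c i) *\<^sub>C x i) = (\<Sum>\<kappa>\<in>S. (t ^ W \<kappa> * prod_list (map c \<kappa>)) *\<^sub>C A (map x \<kappa>))"
      unfolding A(2) multilinear_map_replicate_sum[OF A(1) \<open>finite I\<close>] S_def pw ..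
    also have "\<dots> = (\<Sum>l\<le>N. \<Sum>\<kappa> | \<kappa> \<in> S \<and> W \<kappa> = l. (t ^ W \<kappa> * prod_list (map c \<kappa>)) *\<^sub>C A (map x \<kappa>))"
      by (rule sum.group[symmetric]) (use finS N in auto)
    also have "\<dots> = (\<Sum>l\<le>N. t ^ l *\<^sub>C T l)"
      unfolding T_def complex_vector.scale_sum_right by (intro sum.cong) (auto simp: scaleC_scaleC)
    finally show ?thesis .
  qed
  have T: "norm (T n) \<le> G / 2 ^ n" if "n \<le> N" for n
    using norm_coeff_le_circle_bound[of 2 T N G n] bd that unfolding exp by (simp add: field_simps)
  have "G \<ge> 0" using order_trans[OF norm_ge_zero bd[of 2]] by simp
  have "P (\<Sum>i\<in>I. c i *\<^sub>C x i) = (\<Sum>l\<le>N. T l)" using exp[of 1] by (simp add: scaleC_one)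
  also have "\<dots> = (\<Sum>l\<le>L. T l) + (\<Sum>l\<in>{L<..N}. T l)"
    using N(1) by (subst sum.union_disjoint[symmetric]) (auto intro!: sum.cong)
  also have "(\<Sum>l\<le>L. T l) = (\<Sum>l\<le>L. \<Sum>\<kappa> | \<kappa> \<in> {\<kappa> \<in> S. W \<kappa> \<le> L} \<and> W \<kappa> = l. prod_list (map c \<kappa>) *\<^sub>C A (map x \<kappa>))"
    unfolding T_def by (intro sum.cong) auto
  also have "\<dots> = (\<Sum>\<kappa>\<in>{\<kappa> \<in> S. W \<kappa> \<le> L}. prod_list (map c \<kappa>) *\<^sub>C A (map x \<kappa>))"
    by (rule sum.group) (use finS in auto)
  finally have "P (\<Sum>i\<in>I. c i *\<^sub>C x i) - (\<Sum>\<kappa>\<in>{\<kappa> \<in> S. W \<kappa> \<le> L}. prod_list (map c \<kappa>) *\<^sub>C A (map x \<kappa>)) = (\<Sum>l\<in>{L<..N}. T l)"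
    by simp
  moreover have "norm (\<Sum>l\<in>{L<..N}. T l) \<le> (\<Sum>l\<in>{L<..N}. G / 2 ^ l)"
    by (intro sum_norm_le T) auto
  \<comment> \<open>The subtracted term \<open>G / 2 ^ N\<close> lets the induction on
    \<open>N\<close> telescope.\<close>
  moreover have "(\<Sum>l\<in>{L<..N}. G / 2 ^ l) \<le> G / 2 ^ L - G / 2 ^ N"
    using N(1)
  proof (induction N rule: dec_induct)
    case (step N)
    have "{L<..Suc N} = insert (Suc N) {L<..N}" using step by auto
    moreover have "G / 2 ^ N = G / 2 ^ Suc N + G / 2 ^ Suc N" by simp
    ultimately show ?case using step by (simp del: power_Suc)
  qed simp
  moreover have "G / 2 ^ N \<ge> 0" using \<open>G \<ge> 0\<close> by simp
  moreover have "{\<kappa> \<in> S. W \<kappa> \<le> L} = {\<kappa>. set \<kappa> \<subseteq> I \<and> length \<kappa> = m \<and> sum_list (map wt \<kappa>) \<le> L}"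
    unfolding S_def W_def by auto
  ultimately show ?thesis by simp
qed

section \<open>Counting weighted multisets\<close>

text \<open>For the weights \<open>2 ^ k\<close> these are partitions of the integers up to
  \<open>L\<close> into powers of 2, the part \<open>2 ^ k\<close> having one colour for each basis
  vector of level \<open>k\<close>.\<close>

definition weighted_multisets :: "('i \<Rightarrow> nat) \<Rightarrow> 'i set \<Rightarrow> nat \<Rightarrow> 'i multiset set"
  where "weighted_multisets wt J L = {\<nu>. set_mset \<nu> \<subseteq> J \<and> sum_mset (image_mset wt \<nu>) \<le> L}"

text \<open>Euler's generating function: expanded into geometric series, the product contains
  \<open>x\<close> to the weight of every multiset over \<open>J\<close>, and each weight up to
  \<open>L\<close> contributes at least \<open>x ^ L\<close>. The induction splits on the
  multiplicity \<open>i\<close> of the new element.\<close>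

lemma card_weighted_multisets_le:
  fixes wt :: "'i \<Rightarrow> nat" and x :: real
  assumes "finite J" "\<And>j. j \<in> J \<Longrightarrow> wt j \<ge> 1" "0 < x" "x < 1"
  shows "finite (weighted_multisets wt J L) \<and>
    real (card (weighted_multisets wt J L)) * x ^ L
      \<le> (\<Prod>j\<in>J. 1 / (1 - x ^ wt j))"
  unfolding weighted_multisets_def
  using assms(1,2)
proof (induction J arbitrary: L rule: finite_induct)
  case empty
  have "{\<nu>. set_mset \<nu> \<subseteq> {} \<and> sum_mset (image_mset wt \<nu>) \<le> L} = {{#}}" by auto
  then show ?case using assms(3,4) by (simp add: power_le_one)
next
  case (insert j J)
  let ?F = "\<lambda>J L. {\<nu>. set_mset \<nu> \<subseteq> J \<and> sum_mset (image_mset wt \<nu>) \<le> L}"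
  let ?Q = "\<Prod>j\<in>J. 1 / (1 - x ^ wt j)"
  \<comment> \<open>The condition \<open>i * wt j \<le> L\<close> keeps the subtraction
    \<open>L - i * wt j\<close> exact; \<open>i \<le> L\<close> makes the set visibly
    finite.\<close>
  let ?I = "{i. i \<le> L \<and> i * wt j \<le> L}"
  have IH: "finite (?F J L)" "real (card (?F J L)) * x ^ L \<le> ?Q" for L
    using insert.IH insert.prems by auto
  have wj: "wt j \<ge> 1" using insert.prems by simp
  have Q0: "?Q \<ge> 0"
    using assms(3,4) insert.prems by (intro prod_nonneg) (auto simp: power_le_one)
  have sub: "?F (insert j J) L \<subseteq> (\<Union>i\<in>?I. (\<lambda>\<nu>. replicate_mset i j + \<nu>) ` ?F J (L - i * wt j))"
  proof
    fix \<nu> assume nu: "\<nu> \<in> ?F (insert j J) L"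
    define \<mu> where "\<mu> = filter_mset (\<lambda>y. y \<noteq> j) \<nu>"
    define i where "i = count \<nu> j"
    have eq: "\<nu> = replicate_mset i j + \<mu>"
      unfolding \<mu>_def i_def by (rule multiset_eqI) auto
    have "i * wt j + sum_mset (image_mset wt \<mu>) \<le> L"
      using nu unfolding eq by simp
    moreover from this have "i \<le> L" using mult_le_mono2[OF wj, of i] by linarith
    moreover have "set_mset \<mu> \<subseteq> J" using nu unfolding \<mu>_def by auto
    ultimately have "i \<in> ?I" "\<mu> \<in> ?F J (L - i * wt j)" by auto
    then show "\<nu> \<in> (\<Union>i\<in>?I. (\<lambda>\<nu>. replicate_mset i j + \<nu>) ` ?F J (L - i * wt j))"
      using eq by blast
  qed
  have fin: "finite (\<Union>i\<in>?I. (\<lambda>\<nu>. replicate_mset i j + \<nu>) ` ?F J (L - i * wt j))"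
    using IH(1) by auto
  have "card (?F (insert j J) L) \<le> (\<Sum>i\<in>?I. card (?F J (L - i * wt j)))"
    by (rule order_trans[OF card_mono[OF fin sub] order_trans[OF card_UN_le sum_mono[OF card_image_le]]])
       (use IH(1) in auto)
  then have "real (card (?F (insert j J) L)) * x ^ L
      \<le> (\<Sum>i\<in>?I. real (card (?F J (L - i * wt j)))) * x ^ L"
    using assms(3) by (intro mult_right_mono) (auto simp flip: of_nat_sum)
  also have "\<dots> = (\<Sum>i\<in>?I. real (card (?F J (L - i * wt j))) * x ^ (L - i * wt j) * (x ^ wt j) ^ i)"
    unfolding sum_distrib_right
  proof (intro sum.cong refl)
    fix i assume "i \<in> ?I"
    then have "x ^ L = x ^ (L - i * wt j) * x ^ (i * wt j)" by (simp flip: power_add)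
    then show "real (card (?F J (L - i * wt j))) * x ^ L
        = real (card (?F J (L - i * wt j))) * x ^ (L - i * wt j) * (x ^ wt j) ^ i"
      by (simp add: power_mult[symmetric] mult.commute)
  qed
  also have "\<dots> \<le> (\<Sum>i\<in>?I. ?Q * (x ^ wt j) ^ i)"
    using assms(3) IH(2) by (intro sum_mono mult_right_mono) auto
  also have "\<dots> \<le> ?Q * (\<Sum>i. (x ^ wt j) ^ i)"
    unfolding sum_distrib_left[symmetric]
    using assms(3,4) wj Q0 by (intro mult_left_mono sum_le_suminf summable_geometric)
      (auto simp: power_less_one_iff)
  also have "\<dots> = (\<Prod>j\<in>insert j J. 1 / (1 - x ^ wt j))"
    using assms(3,4) wj insert.hyps by (subst suminf_geometric) (auto simp: power_less_one_iff)
  finally show ?case using finite_subset[OF sub fin] by blast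
qed

text \<open>The left side grows like \<open>ln (1 / y)\<close> at 0 and decays like
  \<open>exp (- y)\<close> at infinity, so every negative power dominates it. The exponent is kept
  free because \<open>dyadic_sum_ln_le\<close> uses two different ones.\<close>

lemma minus_ln_one_minus_exp_le_powr:
  fixes \<beta> :: real
  assumes "\<beta> > 0"
  obtains C where "C \<ge> 0" "\<And>y. y > 0 \<Longrightarrow> - ln (1 - exp (- y)) \<le> C * y powr (- \<beta>)"
proof -
  have e: "- ln (1 - exp (- y)) = ln (1 + 1 / (exp y - 1))" if "y > 0" for y :: real
  proof -
    have "exp y > 1" using that by simp
    then have "inverse (1 - exp (- y)) = 1 + 1 / (exp y - 1)" by (simp add: exp_minus field_simps)
    then show ?thesis using that by (metis ln_inverse diff_gt_0_iff_gt exp_less_one_iff neg_less_0_iff_less)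
  qed
  show ?thesis
  proof (cases "\<beta> < 1")
    case True
    have "- ln (1 - exp (- y)) \<le> (1 + 1 / \<beta>) * y powr (- \<beta>)" if y: "y > 0" for y
    proof -
      define z where "z = 1 / y"
      have z: "z > 0" using y by (simp add: z_def)
      have "1 / (exp y - 1) \<le> z"
        using y exp_ge_add_one_self[of y] unfolding z_def
        by (intro divide_left_mono) (simp_all add: le_diff_eq add.commute)
      then have "ln (1 + 1 / (exp y - 1)) \<le> ln (1 + z)"
        using y by (intro ln_mono) (auto simp: add_pos_nonneg)
      also have "\<dots> \<le> (1 + 1 / \<beta>) * z powr \<beta>"
      proof (cases "z \<le> 1")
        case True
        have "ln (1 + z) \<le> z" using z by (simp add: ln_add_one_self_le_self)
        also have "z = z powr 1" using z by simp
        also have "\<dots> \<le> z powr \<beta>" using z True \<open>\<beta> < 1\<close> by (intro powr_mono') auto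
        also have "\<dots> \<le> (1 + 1 / \<beta>) * z powr \<beta>" using assms by (simp add: algebra_simps)
        finally show ?thesis .
      next
        case False
        have "ln (1 + z) \<le> ln (2 * z)" using False by (intro ln_mono) auto
        also have "\<dots> = ln 2 + ln z" using z by (simp add: ln_mult)
        also have "ln (2::real) \<le> 1" using ln_2_less_1 by simp
        also have "ln z \<le> z powr \<beta> / \<beta>" using ln_powr_bound[of z \<beta>] False assms by simp
        also have "(1::real) \<le> z powr \<beta>" using False assms by (simp add: ge_one_powr_ge_zero)
        finally show ?thesis by (simp add: algebra_simps)
      qed
      also have "z powr \<beta> = y powr (- \<beta>)"
        using y by (simp add: z_def powr_minus powr_divide inverse_eq_divide)
      finally show ?thesis using e[OF y] by simp
    qed
    then show ?thesis using that[of "1 + 1 / \<beta>"] assms by simp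
  next
    case False
    \<comment> \<open>For \<open>\<beta> \<ge> 1\<close> the logarithm is bounded by its argument,
      which leaves \<open>y powr \<beta> \<le> fact n * (exp y - 1)\<close>. The linear term of the
      exponential serves \<open>y \<le> 1\<close>, the term of degree \<open>n\<close> the
      rest.\<close>
    define n where "n = nat \<lceil>\<beta>\<rceil>"
    have n: "\<beta> \<le> real n" "n \<ge> 1" using False unfolding n_def by linarith+
    have "- ln (1 - exp (- y)) \<le> fact n * y powr (- \<beta>)" if y: "y > 0" for y
    proof -
      have y1: "y \<le> exp y - 1" using exp_ge_add_one_self[of y] by (simp only: le_diff_eq add.commute)
      have yn: "y ^ n / fact n \<le> exp y - 1"
      proof -
        have "(\<Sum>i\<in>{0, n}. y ^ i /\<^sub>R fact i) \<le> exp y"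
          unfolding exp_def using y by (intro sum_le_suminf summable_exp_generic) auto
        then show ?thesis using n by (simp add: field_simps)
      qed
      have "y powr \<beta> \<le> fact n * (exp y - 1)"
      proof (cases "y \<le> 1")
        case True
        have "y powr \<beta> \<le> y powr 1" using True False y by (intro powr_mono') auto
        also have "\<dots> \<le> exp y - 1" using y y1 by simp
        also have "\<dots> \<le> fact n * (exp y - 1)" using y fact_ge_1[of n, where 'a=real] by simp
        finally show ?thesis .
      next
        case False
        have "y powr \<beta> \<le> y powr real n" using False n by (intro powr_mono) auto
        also have "\<dots> \<le> fact n * (exp y - 1)" using y yn by (simp add: powr_realpow field_simps)
        finally show ?thesis .
      qed
      then have "1 / (exp y - 1) \<le> fact n * y powr (- \<beta>)"
        using y by (simp add: powr_minus field_simps)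
      moreover have "ln (1 + 1 / (exp y - 1)) \<le> 1 / (exp y - 1)"
        using y by (intro ln_add_one_self_le_self) auto
      ultimately show ?thesis using e[OF y] by simp
    qed
    then show ?thesis using that[of "fact n"] by simp
  qed
qed

text \<open>The exponents \<open>p / 2\<close> and \<open>3 * p / 2\<close> lie on either side of
  the growth rate \<open>p\<close> of the weights. The first for \<open>k \<le> K\<close> and the
  second for \<open>k \<ge> K\<close> give bounds that decay geometrically, with ratio
  \<open>g\<close>, away from the peak at \<open>k = K\<close>; hence the uniformity in
  \<open>q\<close>.\<close>

lemma dyadic_sum_ln_le:
  fixes p :: real
  assumes "p > 0"
  obtains H where "H \<ge> 0"
    "\<And>(K::nat) q. (\<Sum>k\<le>q. 2 powr (real k * p) * - ln (1 - exp (- (2 ^ k / 2 ^ K)))) \<le> H * 2 powr (real K * p)"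
proof -
  obtain C1 where C1: "C1 \<ge> 0" "\<And>y. y > 0 \<Longrightarrow> - ln (1 - exp (- y)) \<le> C1 * y powr (- (p / 2))"
    using minus_ln_one_minus_exp_le_powr[of "p / 2"] assms by auto
  obtain C2 where C2: "C2 \<ge> 0" "\<And>y. y > 0 \<Longrightarrow> - ln (1 - exp (- y)) \<le> C2 * y powr (- (3 * p / 2))"
    using minus_ln_one_minus_exp_le_powr[of "3 * p / 2"] assms by auto
  define g where "g = 2 powr (- (p / 2))"
  have g: "0 < g" "g < 1" using assms by (auto simp: g_def powr_less_one)
  have gn: "g ^ n = 2 powr (- (real n * p / 2))" for n
    unfolding g_def by (simp add: powr_power mult.commute)
  have yk: "(2::real) ^ k / 2 ^ K = 2 powr (real k - real K)" for k K :: nat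
    by (simp add: powr_diff powr_realpow)
  have "(\<Sum>k\<le>q. 2 powr (real k * p) * - ln (1 - exp (- (2 ^ k / 2 ^ K))))
      \<le> ((C1 + C2) / (1 - g)) * 2 powr (real K * p)" for K q :: nat
  proof -
    let ?a = "\<lambda>k. 2 powr (real k * p) * - ln (1 - exp (- (2 ^ k / 2 ^ K)))"
    have a0: "?a k \<ge> 0" for k by (intro mult_nonneg_nonneg) auto
    have a1: "?a k \<le> C1 * 2 powr (real K * p) * g ^ (K - k)" if "k \<le> K" for k
    proof -
      have "?a k \<le> 2 powr (real k * p) * (C1 * 2 powr ((real k - real K) * - (p / 2)))"
        using C1(2)[of "2 ^ k / 2 ^ K"] unfolding yk powr_powr by (intro mult_left_mono) auto
      also have "\<dots> = C1 * 2 powr (real k * p + (real k - real K) * - (p / 2))"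
        by (simp only: powr_add mult_ac)
      also have "real k * p + (real k - real K) * - (p / 2) = real K * p + - (real (K - k) * p / 2)"
        using that by (simp add: of_nat_diff field_simps)
      finally show ?thesis unfolding gn by (simp only: powr_add mult_ac)
    qed
    have a2: "?a k \<le> C2 * 2 powr (real K * p) * g ^ (k - K)" if "K \<le> k" for k
    proof -
      have "?a k \<le> 2 powr (real k * p) * (C2 * 2 powr ((real k - real K) * - (3 * p / 2)))"
        using C2(2)[of "2 ^ k / 2 ^ K"] unfolding yk powr_powr by (intro mult_left_mono) auto
      also have "\<dots> = C2 * 2 powr (real k * p + (real k - real K) * - (3 * p / 2))"
        by (simp only: powr_add mult_ac)
      also have "real k * p + (real k - real K) * - (3 * p / 2) = real K * p + - (real (k - K) * p / 2)"
        using that by (simp add: of_nat_diff field_simps)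
      finally show ?thesis unfolding gn by (simp only: powr_add mult_ac)
    qed
    have geo: "(\<Sum>k\<in>S. g ^ f k) \<le> 1 / (1 - g)" if "finite S" "inj_on f S" for S and f :: "nat \<Rightarrow> nat"
    proof -
      have "(\<Sum>k\<in>S. g ^ f k) = (\<Sum>i\<in>f ` S. g ^ i)" using that by (simp add: sum.reindex)
      also have "\<dots> \<le> (\<Sum>i. g ^ i)" using g that by (intro sum_le_suminf summable_geometric) auto
      finally show ?thesis using g by (simp add: suminf_geometric)
    qed
    have "(\<Sum>k\<le>q. ?a k) \<le> (\<Sum>k\<in>{..K} \<union> {K<..q}. ?a k)"
      using a0 by (intro sum_mono2) auto
    also have "\<dots> = (\<Sum>k\<le>K. ?a k) + (\<Sum>k\<in>{K<..q}. ?a k)"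
      by (intro sum.union_disjoint) auto
    also have "(\<Sum>k\<le>K. ?a k) \<le> (\<Sum>k\<le>K. C1 * 2 powr (real K * p) * g ^ (K - k))"
      using a1 by (intro sum_mono) auto
    also have "\<dots> \<le> C1 * 2 powr (real K * p) * (1 / (1 - g))"
      unfolding sum_distrib_left[symmetric] using C1 by (intro mult_left_mono geo) (auto simp: inj_on_def)
    also have "(\<Sum>k\<in>{K<..q}. ?a k) \<le> (\<Sum>k\<in>{K<..q}. C2 * 2 powr (real K * p) * g ^ (k - K))"
      using a2 by (intro sum_mono) auto
    also have "\<dots> \<le> C2 * 2 powr (real K * p) * (1 / (1 - g))"
      unfolding sum_distrib_left[symmetric] using C2 by (intro mult_left_mono geo) (auto simp: inj_on_def)
    finally show ?thesis by (simp add: field_simps add_divide_distrib)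
  qed
  moreover have "(C1 + C2) / (1 - g) \<ge> 0" using C1 C2 g by simp
  ultimately show ?thesis using that by blast
qed

text \<open>For \<open>p = 1 / \<alpha>\<close> and the cut-off \<open>L\<close> used here,
  \<open>2 powr (real K * p)\<close> is of order \<open>L powr (1 / (\<alpha> + 1))\<close>. Levels
  beyond \<open>L\<close> are left out, as their weight \<open>2 ^ k\<close> exceeds
  \<open>L\<close>. \<open>H\<close> is chosen before \<open>B\<close> and \<open>K\<close>, so one
  constant serves all scales.\<close>

lemma card_dyadic_multisets:
  fixes p A :: real
  assumes "p > 0" "A \<ge> 0"
  shows "\<exists>H\<ge>0. \<forall>(B :: nat \<Rightarrow> 'b set) K. (\<forall>k. finite (B k) \<and> card (B k) \<le> A * 2 powr (real k * p)) \<longrightarrow>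
    (let M = weighted_multisets (\<lambda>i. 2 ^ fst i) (Sigma {..nat \<lceil>2 powr (real K * (1 + p))\<rceil>} B)
       (nat \<lceil>2 powr (real K * (1 + p))\<rceil>)
     in finite M \<and> card M \<le> exp (H * 2 powr (real K * p)))"
proof -
  obtain H where H: "H \<ge> 0"
    "\<And>(K::nat) q. (\<Sum>k\<le>q. 2 powr (real k * p) * - ln (1 - exp (- (2 ^ k / 2 ^ K)))) \<le> H * 2 powr (real K * p)"
    by (rule dyadic_sum_ln_le[OF assms(1)]) (rule that)
  show ?thesis
  \<comment> \<open>The 2 pays for dividing by \<open>x ^ L\<close>, including the rounding of
    \<open>L\<close>; \<open>A * H\<close> pays for the product.\<close>
  proof (intro exI[of _ "2 + A * H"] conjI allI impI)
    show "2 + A * H \<ge> 0" using H(1) assms by simp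
    fix B :: "nat \<Rightarrow> 'b set" and K
    assume "\<forall>k. finite (B k) \<and> card (B k) \<le> A * 2 powr (real k * p)"
    then have finB: "\<And>k. finite (B k)" and cardB: "\<And>k. card (B k) \<le> A * 2 powr (real k * p)" by auto
    define L where "L = nat \<lceil>2 powr (real K * (1 + p))\<rceil>"
    let ?M = "weighted_multisets (\<lambda>i. 2 ^ fst i) (Sigma {..L} B) L"
    let ?g = "\<lambda>k. 1 - exp (- (2 ^ k / 2 ^ K) :: real)"
    \<comment> \<open>Balances \<open>x ^ L\<close> against the product: both have logarithm of order \<open>2 powr (K p)\<close>.\<close>
    define x where "x = exp (- (1 / 2 ^ K) :: real)"
    have xk: "x ^ (2 ^ k) = exp (- (2 ^ k / 2 ^ K))" for k
      unfolding x_def by (simp flip: exp_of_nat_mult)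
    have M: "finite ?M" "card ?M * x ^ L \<le> (\<Prod>j\<in>Sigma {..L} B. 1 / (1 - x ^ (2 ^ fst j)))"
      using card_weighted_multisets_le[of "Sigma {..L} B" "\<lambda>i. 2 ^ fst i" x L] finB
      by (auto simp: x_def)
    have g: "?g k > 0" "?g k \<le> 1" for k by auto
    have "(\<Prod>j\<in>Sigma {..L} B. 1 / (1 - x ^ (2 ^ fst j))) = (\<Prod>k\<le>L. \<Prod>b\<in>B k. 1 / ?g k)"
      unfolding xk using finB by (subst prod.Sigma) (auto simp: case_prod_unfold)
    also have "\<dots> = (\<Prod>k\<le>L. exp (card (B k) * - ln (?g k)))"
      using g by (intro prod.cong refl) (simp add: exp_of_nat_mult exp_minus inverse_eq_divide power_one_over)
    also have "\<dots> = exp (\<Sum>k\<le>L. card (B k) * - ln (?g k))"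
      by (simp add: exp_sum)
    also have "(\<Sum>k\<le>L. card (B k) * - ln (?g k)) \<le> (\<Sum>k\<le>L. A * 2 powr (real k * p) * - ln (?g k))"
      using cardB g by (intro sum_mono mult_right_mono) auto
    also have "\<dots> \<le> A * (H * 2 powr (real K * p))"
      unfolding mult.assoc sum_distrib_left[symmetric] using H(2) assms by (intro mult_left_mono) auto
    finally have P: "(\<Prod>j\<in>Sigma {..L} B. 1 / (1 - x ^ (2 ^ fst j))) \<le> exp (A * (H * 2 powr (real K * p)))"
      by simp
    have "2 powr (real K * (1 + p)) > 0" by simp
    then have "real L \<le> 2 powr (real K * (1 + p)) + 1" unfolding L_def by linarith
    then have "real L / 2 ^ K \<le> (2 powr (real K * (1 + p)) + 1) / 2 ^ K"
      by (intro divide_right_mono) auto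
    also have "\<dots> = 2 powr (real K * p) + 1 / 2 ^ K"
      by (simp add: distrib_left powr_add powr_realpow add_divide_distrib)
    also have "1 / 2 ^ K \<le> 2 powr (real K * p)"
    proof -
      have "1 / 2 ^ K \<le> (1::real)" by simp
      also have "1 \<le> 2 powr (real K * p)" using assms by (simp add: ge_one_powr_ge_zero)
      finally show ?thesis .
    qed
    finally have L': "real L / 2 ^ K \<le> 2 * 2 powr (real K * p)" by simp
    have xL: "x ^ L = exp (- (real L / 2 ^ K))" unfolding x_def by (simp flip: exp_of_nat_mult)
    have "card ?M = card ?M * x ^ L * exp (real L / 2 ^ K)"
      unfolding xL by (simp add: exp_minus)
    also have "\<dots> \<le> exp (A * (H * 2 powr (real K * p))) * exp (2 * 2 powr (real K * p))"
      using M(2) P L' by (intro mult_mono) auto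
    also have "\<dots> = exp ((2 + A * H) * 2 powr (real K * p))"
      by (simp add: algebra_simps flip: exp_add)
    finally show "let M = weighted_multisets (\<lambda>i. 2 ^ fst i) (Sigma {..nat \<lceil>2 powr (real K * (1 + p))\<rceil>} B)
       (nat \<lceil>2 powr (real K * (1 + p))\<rceil>)
     in finite M \<and> card M \<le> exp ((2 + A * H) * 2 powr (real K * p))"
      using M(1) unfolding L_def Let_def by simp
  qed
qed

section \<open>Local approximation of holomorphic maps\<close>

text \<open>Scalars commute, so all orderings of a multiset \<open>\<nu>\<close> carry the same
  coefficient, and the sum of \<open>A\<close> over them is a vector independent of
  \<open>c\<close>. The degree is \<open>size \<nu>\<close>, so one family serves all
  \<open>m \<ge> 1\<close> and leaves \<open>{#}\<close> free for the constant term. An index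
  occurring in a word of weight at most \<open>L\<close> itself has weight at most \<open>L\<close>,
  hence lies in \<open>J\<close>.\<close>

lemma weighted_sum_in_span:
  fixes A :: "nat \<Rightarrow> 'a list \<Rightarrow> 'b::complex_normed_vector"
    and wt :: "'i \<Rightarrow> nat"
  assumes "finite I" and J: "\<And>i. i \<in> I \<Longrightarrow> wt i \<le> L \<Longrightarrow> i \<in> J"
  shows "e + (\<Sum>m=1..N. \<Sum>\<kappa> | set \<kappa> \<subseteq> I \<and> length \<kappa> = m \<and> sum_list (map wt \<kappa>) \<le> L.
      prod_list (map c \<kappa>) *\<^sub>C A m (map x \<kappa>)) \<in>
    cspan ((\<lambda>\<nu>. if \<nu> = {#} then e else \<Sum>\<kappa> | mset \<kappa> = \<nu>. A (size \<nu>) (map x \<kappa>)) `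
      weighted_multisets wt J L)"
    (is "_ \<in> cspan (?E ` ?M)")
proof (rule complex_vector.span_add[OF _ complex_vector.span_sum])
  show "e \<in> cspan (?E ` ?M)"
    by (rule complex_vector.span_base, rule image_eqI[of _ _ "{#}"]) (auto simp: weighted_multisets_def)
next
  fix m assume m: "m \<in> {1..N}"
  let ?S = "{\<kappa>. set \<kappa> \<subseteq> I \<and> length \<kappa> = m \<and> sum_list (map wt \<kappa>) \<le> L}"
  have finS: "finite ?S"
    by (rule finite_subset[OF _ finite_lists_length_eq[OF \<open>finite I\<close>, of m]]) auto
  have inner: "(\<Sum>\<kappa> | \<kappa> \<in> ?S \<and> mset \<kappa> = \<nu>. prod_list (map c \<kappa>) *\<^sub>C A m (map x \<kappa>)) =
      prod_mset (image_mset c \<nu>) *\<^sub>C ?E \<nu>" if nuS: "\<nu> \<in> mset ` ?S" for \<nu>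
  proof -
    obtain \<kappa>0 where k0: "\<kappa>0 \<in> ?S" "\<nu> = mset \<kappa>0" using nuS by blast
    have mem: "\<kappa> \<in> ?S" if "mset \<kappa> = \<nu>" for \<kappa>
    proof -
      have "mset \<kappa> = mset \<kappa>0" using that k0 by simp
      then have "set \<kappa> = set \<kappa>0" "length \<kappa> = length \<kappa>0" "sum_list (map wt \<kappa>) = sum_list (map wt \<kappa>0)"
        by (metis mset_eq_setD, metis mset_eq_length, metis mset_map sum_mset_sum_list)
      then show ?thesis using k0(1) by simp
    qed
    have nu: "\<nu> \<noteq> {#}" "size \<nu> = m" using k0 m by auto
    have "(\<Sum>\<kappa> | \<kappa> \<in> ?S \<and> mset \<kappa> = \<nu>. prod_list (map c \<kappa>) *\<^sub>C A m (map x \<kappa>)) =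
        (\<Sum>\<kappa> | mset \<kappa> = \<nu>. prod_mset (image_mset c \<nu>) *\<^sub>C A m (map x \<kappa>))"
    proof (rule sum.cong)
      show "{\<kappa>. \<kappa> \<in> ?S \<and> mset \<kappa> = \<nu>} = {\<kappa>. mset \<kappa> = \<nu>}" using mem by auto
      fix \<kappa> assume "\<kappa> \<in> {\<kappa>. mset \<kappa> = \<nu>}"
      then show "prod_list (map c \<kappa>) *\<^sub>C A m (map x \<kappa>) = prod_mset (image_mset c \<nu>) *\<^sub>C A m (map x \<kappa>)"
        by (auto simp: prod_mset_prod_list simp flip: mset_map)
    qed
    then show ?thesis using nu by (simp add: complex_vector.scale_sum_right)
  qed
  have "(\<Sum>\<kappa>\<in>?S. prod_list (map c \<kappa>) *\<^sub>C A m (map x \<kappa>)) =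
      (\<Sum>\<nu>\<in>mset ` ?S. prod_mset (image_mset c \<nu>) *\<^sub>C ?E \<nu>)"
    by (subst sum.image_gen[OF finS, of _ mset], rule sum.cong[OF refl inner]) 
  also have "\<dots> \<in> cspan (?E ` ?M)"
  proof (intro complex_vector.span_sum complex_vector.span_scale complex_vector.span_base imageI)
    fix \<nu> assume "\<nu> \<in> mset ` ?S"
    then obtain \<kappa> where k: "set \<kappa> \<subseteq> I" "sum_list (map wt \<kappa>) \<le> L" "\<nu> = mset \<kappa>" by auto
    have "i \<in> J" if "i \<in> set \<kappa>" for i
    proof (rule J)
      show "i \<in> I" using that k by auto
      have "wt i \<le> sum_list (map wt \<kappa>)" using that by (intro member_le_sum_list) auto
      then show "wt i \<le> L" using k by simp
    qed
    moreover have "sum_mset (image_mset wt \<nu>) \<le> L"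
      using k by (metis mset_map sum_mset_sum_list)
    ultimately show "\<nu> \<in> ?M" using k by (auto simp: weighted_multisets_def)
  qed
  finally show "(\<Sum>\<kappa>\<in>?S. prod_list (map c \<kappa>) *\<^sub>C A m (map x \<kappa>)) \<in> cspan (?E ` ?M)" .
qed

text \<open>A late term is the difference of two partial sums within 1/2 of \<open>u\<close>, by
  uniform convergence; the finitely many early ones are bounded near 0 by continuity. Homogeneity
  with factor 2 turns the bound 1 on the ball of radius \<open>\<sigma>\<close> into
  \<open>(1 / 2) ^ m\<close> on the ball of half that radius.\<close>

lemma banach_holomorphic_on_expansion:
  assumes "banach_holomorphic_on u U" "x0 \<in> U"
  obtains \<rho> A where "\<rho> > 0" "\<And>m. m \<ge> 1 \<Longrightarrow> multilinear_map m (A m)"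
    "\<And>m z. m \<ge> 1 \<Longrightarrow> norm z < \<rho> \<Longrightarrow> norm (A m (replicate m z)) \<le> (1 / 2) ^ m"
    "\<And>z. norm z < \<rho> \<Longrightarrow> (\<lambda>N. u x0 + (\<Sum>m=1..N. A m (replicate m z))) \<longlonglongrightarrow> u (x0 + z)"
proof -
  obtain r P where r: "r > 0" and chp: "\<And>m. m \<ge> 1 \<Longrightarrow> continuous_homogeneous_polynomial m (P m)"
    and ul: "uniform_limit (ball x0 r) (\<lambda>N x. u x0 + (\<Sum>m=1..N. P m (x - x0))) u sequentially"
    using assms unfolding banach_holomorphic_on_def by metis
  have "\<forall>m. \<exists>A. m \<ge> 1 \<longrightarrow> multilinear_map m A \<and> (\<forall>x. P m x = A (replicate m x))"
    using chp unfolding continuous_homogeneous_polynomial_def by metis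
  then obtain A where A: "\<And>m. m \<ge> 1 \<Longrightarrow> multilinear_map m (A m)"
      "\<And>m x. m \<ge> 1 \<Longrightarrow> P m x = A m (replicate m x)"
    by metis
  have lim: "(\<lambda>N. u x0 + (\<Sum>m=1..N. P m z)) \<longlonglongrightarrow> u (x0 + z)" if "norm z < r" for z
    using tendsto_uniform_limitI[OF ul, of "x0 + z"] that by (simp add: dist_norm)
  obtain N0 where N0: "\<And>N x. N \<ge> N0 \<Longrightarrow> x \<in> ball x0 r \<Longrightarrow>
      dist (u x0 + (\<Sum>m=1..N. P m (x - x0))) (u x) < 1 / 2"
    using uniform_limitD[OF ul, of "1 / 2"] unfolding eventually_sequentially by (meson half_gt_zero_iff zero_less_one)
  have big: "norm (P m z) \<le> 1" if "m > N0" "norm z < r" for m z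
  proof -
    obtain N where N: "m = Suc N" "N \<ge> N0" using \<open>m > N0\<close> by (cases m) auto
    let ?s = "\<lambda>N. u x0 + (\<Sum>m=1..N. P m z)"
    have "dist (?s (Suc N)) (u (x0 + z)) < 1 / 2" "dist (?s N) (u (x0 + z)) < 1 / 2"
      using N0[of "Suc N" "x0 + z"] N0[of N "x0 + z"] N that by (auto simp: dist_norm)
    then have "dist (?s (Suc N)) (?s N) < 1"
      by (smt (verit) dist_triangle2 field_sum_of_halves)
    then show ?thesis using N by (simp add: dist_norm)
  qed
  have "\<exists>s>0. \<forall>z. norm z < s \<longrightarrow> norm (P m z) \<le> 1" if "m \<ge> 1" for m
  proof -
    have "P m 0 = 0"
      using continuous_homogeneous_polynomial_scaleC[OF chp[OF that], of 0 0] that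
      by (simp add: power_0_left)
    moreover have "isCont (P m) 0"
      using chp[OF that] by (simp add: continuous_homogeneous_polynomial_def continuous_on_eq_continuous_at)
    ultimately obtain s where "s > 0" "\<And>z. dist z 0 < s \<Longrightarrow> dist (P m z) 0 < 1"
      unfolding continuous_at_eps_delta by (metis zero_less_one)
    then show ?thesis by (intro exI[of _ s]) (auto simp: less_imp_le)
  qed
  then obtain s where s: "\<And>m. m \<ge> 1 \<Longrightarrow> s m > 0"
      "\<And>m z. m \<ge> 1 \<Longrightarrow> norm z < s m \<Longrightarrow> norm (P m z) \<le> 1"
    by metis
  define \<sigma> where "\<sigma> = Min (insert r (s ` {1..N0}))"
  have sig: "\<sigma> > 0" "\<sigma> \<le> r" "\<And>m. 1 \<le> m \<Longrightarrow> m \<le> N0 \<Longrightarrow> \<sigma> \<le> s m"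
    unfolding \<sigma>_def using r s(1) by (simp, simp, intro Min_le) auto
  have P1: "norm (P m z) \<le> 1" if "m \<ge> 1" "norm z < \<sigma>" for m z
  proof (cases "m \<le> N0")
    case True
    then show ?thesis using s(2)[of m z] sig(3)[of m] that by simp
  qed (use big[of m z] sig that in auto)
  have half: "norm (P m z) \<le> (1 / 2) ^ m" if "m \<ge> 1" "norm z < \<sigma> / 2" for m z
  proof -
    have "norm (2 *\<^sub>C z) < \<sigma>" using that by (simp add: norm_scaleC)
    then have "norm (2 ^ m *\<^sub>C P m z) \<le> 1"
      using P1[OF \<open>m \<ge> 1\<close>, of "2 *\<^sub>C z"]
      by (simp add: continuous_homogeneous_polynomial_scaleC[OF chp[OF \<open>m \<ge> 1\<close>]])
    then show ?thesis by (simp add: norm_scaleC norm_power field_simps)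
  qed
  show ?thesis
  proof (rule that[of "\<sigma> / 2" A])
    fix z :: 'a assume "norm z < \<sigma> / 2"
    then show "(\<lambda>N. u x0 + (\<Sum>m=1..N. A m (replicate m z))) \<longlonglongrightarrow> u (x0 + z)"
      using lim[of z] sig A(2) by simp
  qed (use sig A half in auto)
qed

text \<open>There are two errors of size \<open>1 / 2 ^ L\<close>: one from cutting the Taylor
  series at \<open>N\<close>, one from dropping heavy words, where the factors
  \<open>(1 / 2) ^ m\<close> sum to at most 1 over the degrees.\<close>

lemma weighted_approximation:
  fixes A :: "nat \<Rightarrow> 'a::complex_normed_vector list \<Rightarrow> 'b::complex_normed_vector"
    and wt :: "'i \<Rightarrow> nat"
  assumes A: "\<And>m. m \<ge> 1 \<Longrightarrow> multilinear_map m (A m)"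
    and bd: "\<And>m z. m \<ge> 1 \<Longrightarrow> norm z < \<rho> \<Longrightarrow> norm (A m (replicate m z)) \<le> (1 / 2) ^ m"
    and lim: "\<And>z. norm z < \<rho> \<Longrightarrow> (\<lambda>N. e + (\<Sum>m=1..N. A m (replicate m z))) \<longlonglongrightarrow> f z"
    and I: "finite I" "\<And>i. i \<in> I \<Longrightarrow> wt i \<le> L \<Longrightarrow> i \<in> J"
    and z: "z = (\<Sum>i\<in>I. c i *\<^sub>C x i)" "norm z < \<rho>"
    and circle: "\<And>t. cmod t = 2 \<Longrightarrow> norm (\<Sum>i\<in>I. (t ^ wt i * c i) *\<^sub>C x i) < \<rho>"
  shows "\<exists>v\<in>cspan ((\<lambda>\<nu>. if \<nu> = {#} then e else \<Sum>\<kappa> | mset \<kappa> = \<nu>. A (size \<nu>) (map x \<kappa>)) `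
      weighted_multisets wt J L). norm (f z - v) \<le> 2 / 2 ^ L"
proof -
  let ?s = "\<lambda>N. e + (\<Sum>m=1..N. A m (replicate m z))"
  let ?k = "\<lambda>m. \<Sum>\<kappa> | set \<kappa> \<subseteq> I \<and> length \<kappa> = m \<and> sum_list (map wt \<kappa>) \<le> L.
      prod_list (map c \<kappa>) *\<^sub>C A m (map x \<kappa>)"
  \<comment> \<open>\<open>N\<close> depends on \<open>z\<close>, but the spanning vectors involve
    neither \<open>N\<close> nor \<open>c\<close>, so the space is common to all
    \<open>z\<close>.\<close>
  obtain N where N: "dist (?s N) (f z) < 1 / 2 ^ L"
    using tendstoD[OF lim[OF z(2)], of "1 / 2 ^ L"] unfolding eventually_sequentially by auto
  have "norm (?s N - (e + (\<Sum>m=1..N. ?k m))) = norm (\<Sum>m=1..N. A m (replicate m z) - ?k m)"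
    by (simp add: sum_subtractf)
  also have "\<dots> \<le> (\<Sum>m=1..N. (1 / 2) ^ m / 2 ^ L)"
  proof (intro sum_norm_le)
    fix m assume "m \<in> {1..N}"
    then have m: "m \<ge> 1" by simp
    show "norm (A m (replicate m z) - ?k m) \<le> (1 / 2) ^ m / 2 ^ L"
      unfolding z(1)
      by (rule norm_weighted_tail_le[OF A[OF m] refl I(1)]) (use circle bd[OF m] in auto)
  qed
  also have "\<dots> \<le> (1 - (1 / 2) ^ N) / 2 ^ L"
    unfolding sum_divide_distrib[symmetric]
    by (intro divide_right_mono, induction N) auto
  also have "\<dots> \<le> 1 / 2 ^ L" by (simp add: divide_right_mono)
  finally have "norm (f z - (e + (\<Sum>m=1..N. ?k m))) \<le> 1 / 2 ^ L + 1 / 2 ^ L"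
    using N by (intro norm_diff_triangle_le[of _ "?s N"]) (auto simp: dist_norm norm_minus_commute)
  then show ?thesis using weighted_sum_in_span[OF I] by (intro bexI) auto
qed

text \<open>\<open>B k\<close> joins two neighbouring levels so that the increment
  \<open>v k - v (k - 1)\<close> lies in its span; \<open>x0\<close> enters \<open>B 0\<close> for
  the first piece \<open>v 0 - x0\<close>. Only \<open>I\<close> and \<open>c\<close> depend on
  \<open>a\<close>, the sets \<open>B k\<close> do not.\<close>

lemma dyadic_decomposition:
  fixes G :: "nat \<Rightarrow> 'a::complex_normed_vector set"
  assumes fin: "\<And>k. finite (G k)"
    and ap: "\<And>k. \<exists>v\<in>cspan (G k). norm (a - v) \<le> \<delta> / 2 ^ 2 ^ (k + 2)"
    and a: "norm (a - x0) < \<delta>"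
  defines "B \<equiv> case_nat (insert x0 (G 0)) (\<lambda>j. G j \<union> G (Suc j))"
  obtains I c where "finite I" "\<And>i. i \<in> I \<Longrightarrow> 2 ^ fst i \<le> L \<Longrightarrow> i \<in> Sigma {..L} B"
    "a - x0 = (\<Sum>i\<in>I. c i *\<^sub>C snd i)"
    "\<And>t. cmod t = 2 \<Longrightarrow> norm (\<Sum>i\<in>I. (t ^ 2 ^ fst i * c i) *\<^sub>C snd i) < 5 * \<delta>"
proof -
  obtain v where v: "\<And>k. v k \<in> cspan (G k)" "\<And>k. norm (a - v k) \<le> \<delta> / 2 ^ 2 ^ (k + 2)"
    using ap by metis
  have "\<delta> > 0" using a norm_ge_zero[of "a - x0"] by linarith
  define w where "w = case_nat (v 0 - x0) (\<lambda>j. if j < L then v (Suc j) - v j else a - v L)"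
  have finB: "finite (B k)" for k unfolding B_def using fin by (cases k) auto
  have wB: "w k \<in> cspan (B k)" if "k \<le> L" for k
  proof (cases k)
    case 0
    have "v 0 \<in> cspan (B 0)"
      using v(1)[of 0] complex_vector.span_mono[of "G 0" "B 0"] by (auto simp: B_def)
    moreover have "x0 \<in> cspan (B 0)" by (intro complex_vector.span_base) (simp add: B_def)
    ultimately show ?thesis using 0 by (simp add: w_def complex_vector.span_diff)
  next
    case (Suc j)
    have "v j \<in> cspan (B k)" "v k \<in> cspan (B k)"
      using v(1)[of j] v(1)[of k] complex_vector.span_mono[of "G j" "B k"]
        complex_vector.span_mono[of "G k" "B k"] Suc by (auto simp: B_def)
    then show ?thesis using Suc that by (simp add: w_def complex_vector.span_diff)
  qed
  have "\<exists>d. w k = (\<Sum>b\<in>B k. d b *\<^sub>C b)" if "k \<le> L" for k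
    using wB[OF that] unfolding complex_vector.span_finite[OF finB] by auto
  then obtain d where d: "\<And>k. k \<le> L \<Longrightarrow> w k = (\<Sum>b\<in>B k. d k b *\<^sub>C b)" by metis
  \<comment> \<open>The remainder \<open>w (Suc L)\<close> is an index of its own: its weight exceeds \<open>L\<close>, so no finite-dimensional space needs to contain it.\<close>
  define I where "I = insert (Suc L, w (Suc L)) (Sigma {..L} B)"
  define c where "c = (\<lambda>(k, b). if k \<le> L then d k b else 1)"
  have sumI: "(\<Sum>i\<in>I. (t ^ 2 ^ fst i * c i) *\<^sub>C snd i) = (\<Sum>k\<le>Suc L. t ^ 2 ^ k *\<^sub>C w k)" for t
  proof -
    have "(\<Sum>i\<in>I. (t ^ 2 ^ fst i * c i) *\<^sub>C snd i) =
        t ^ 2 ^ Suc L *\<^sub>C w (Suc L) + (\<Sum>i\<in>Sigma {..L} B. (t ^ 2 ^ fst i * c i) *\<^sub>C snd i)"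
      unfolding I_def using finB by (subst sum.insert) (auto simp: c_def)
    also have "(\<Sum>i\<in>Sigma {..L} B. (t ^ 2 ^ fst i * c i) *\<^sub>C snd i) =
        (\<Sum>k\<le>L. \<Sum>b\<in>B k. (t ^ 2 ^ k * c (k, b)) *\<^sub>C b)"
      using finB by (subst sum.Sigma) (auto simp: case_prod_unfold)
    also have "\<dots> = (\<Sum>k\<le>L. t ^ 2 ^ k *\<^sub>C w k)"
      by (intro sum.cong refl) (simp add: d c_def complex_vector.scale_sum_right scaleC_scaleC)
    finally show ?thesis by simp
  qed
  have "(\<Sum>k\<le>n. w k) = v n - x0" if "n \<le> L" for n
    using that by (induction n) (auto simp: w_def)
  then have sumw: "(\<Sum>k\<le>Suc L. w k) = a - x0" by (simp add: w_def)
  have wS: "2 ^ 2 ^ Suc j * norm (w (Suc j)) \<le> \<delta> * (1 / 2) ^ j" if "j \<le> L" for j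
  proof -
    have "norm (v (Suc j) - v j) \<le> \<delta> / 2 ^ 2 ^ (Suc j + 2) + \<delta> / 2 ^ 2 ^ (j + 2)"
      using v(2)[of "Suc j"] v(2)[of j]
      by (intro norm_diff_triangle_le[of _ a]) (auto simp: norm_minus_commute)
    also have "\<delta> / 2 ^ 2 ^ (Suc j + 2) \<le> \<delta> / 2 ^ 2 ^ (j + 2)"
      using \<open>\<delta> > 0\<close> by (intro divide_left_mono power_increasing) auto
    finally have 1: "norm (v (Suc j) - v j) \<le> 2 * (\<delta> / 2 ^ 2 ^ (j + 2))" by simp
    have "norm (w (Suc j)) \<le> 2 * (\<delta> / 2 ^ 2 ^ (j + 2))"
    proof (cases "j < L")
      case True
      then show ?thesis using 1 by (simp add: w_def)
    next
      case False
      have "\<delta> / 2 ^ 2 ^ (j + 2) \<ge> 0" using \<open>\<delta> > 0\<close> by simp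
      then show ?thesis using v(2)[of j] False that by (simp add: w_def)
    qed
    then have "2 ^ 2 ^ Suc j * norm (w (Suc j)) \<le> 2 ^ 2 ^ Suc j * (2 * (\<delta> / 2 ^ 2 ^ (j + 2)))"
      by (intro mult_left_mono) auto
    \<comment> \<open>The accuracy contains the square of \<open>2 ^ 2 ^ Suc j\<close>: one factor
      cancels the growth of \<open>t ^ 2 ^ Suc j\<close> on the circle, the other makes the sum over
      levels converge.\<close>
    also have "(2::real) ^ 2 ^ (j + 2) = 2 ^ 2 ^ Suc j * 2 ^ 2 ^ Suc j"
      by (simp add: power_add[symmetric])
    also have "2 ^ 2 ^ Suc j * (2 * (\<delta> / (2 ^ 2 ^ Suc j * 2 ^ 2 ^ Suc j))) = 2 * (\<delta> / 2 ^ 2 ^ Suc j)"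
      by (simp del: power_Suc)
    also have "\<dots> \<le> 2 * (\<delta> / 2 ^ Suc j)"
      using \<open>\<delta> > 0\<close> less_imp_le[OF less_exp[of "Suc j"]]
      by (intro mult_left_mono divide_left_mono power_increasing) (simp_all del: power_Suc)
    finally show ?thesis by (simp add: power_divide)
  qed
  have w0: "2 ^ 2 ^ 0 * norm (w 0) \<le> 2 * (\<delta> / 16 + norm (a - x0))"
    using norm_diff_triangle_le[of "v 0" a "\<delta> / 16" x0 "norm (a - x0)"] v(2)[of 0]
    by (simp add: w_def norm_minus_commute)
  \<comment> \<open>The initial piece contributes less than
    \<open>2 * (\<delta> / 16 + \<delta>)\<close> and the others at most
    \<open>2 * \<delta>\<close>.\<close>
  have circle: "norm (\<Sum>i\<in>I. (t ^ 2 ^ fst i * c i) *\<^sub>C snd i) < 5 * \<delta>" if "cmod t = 2" for t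
  proof -
    have "norm (\<Sum>k\<le>Suc L. t ^ 2 ^ k *\<^sub>C w k) \<le> (\<Sum>k\<le>Suc L. 2 ^ 2 ^ k * norm (w k))"
      by (intro sum_norm_le) (simp add: norm_scaleC norm_power that)
    also have "\<dots> = 2 ^ 2 ^ 0 * norm (w 0) + (\<Sum>j\<le>L. 2 ^ 2 ^ Suc j * norm (w (Suc j)))"
      by (rule sum.atMost_Suc_shift)
    also have "(\<Sum>j\<le>L. 2 ^ 2 ^ Suc j * norm (w (Suc j))) \<le> \<delta> * (\<Sum>j\<le>L. (1 / 2) ^ j)"
      unfolding sum_distrib_left by (intro sum_mono wS) auto
    also have "(\<Sum>j\<le>L. (1 / 2) ^ j) \<le> (2::real)"
      by (subst sum_gp0) (auto simp: field_simps)
    finally show ?thesis unfolding sumI using w0 a \<open>\<delta> > 0\<close> by simp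
  qed
  show ?thesis
  proof (rule that[of I c])
    show "finite I" unfolding I_def using finB by auto
    show "i \<in> Sigma {..L} B" if "i \<in> I" "2 ^ fst i \<le> L" for i
    proof -
      have "fst i \<noteq> Suc L"
        using that(2) less_exp[of "Suc L"] by auto
      then show ?thesis using that(1) unfolding I_def by auto
    qed
    show "a - x0 = (\<Sum>i\<in>I. c i *\<^sub>C snd i)"
      using sumI[of 1] sumw by (simp add: scaleC_one del: sum.atMost_Suc)
    show "norm (\<Sum>i\<in>I. (t ^ 2 ^ fst i * c i) *\<^sub>C snd i) < 5 * \<delta>" if "cmod t = 2" for t
      by (rule circle[OF that])
  qed
qed

text \<open>The Taylor expansion at \<open>x0\<close> fixes \<open>\<delta>\<close>, which is both
  the radius of the ball and the scale of accuracy required of \<open>G\<close>; hence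
  \<open>G\<close> must be available for every \<open>\<delta> > 0\<close>. \<open>\<delta>\<close>
  and \<open>H\<close> precede \<open>n\<close>, as the compactness argument requires.\<close>

lemma local_span_approximation:
  fixes u :: "'x::complex_normed_vector \<Rightarrow> 'y::complex_normed_vector"
  assumes "banach_holomorphic_on u U" "x0 \<in> U" "p > 0"
    and G: "\<And>\<delta>. \<delta> > 0 \<Longrightarrow> \<exists>A\<ge>0. \<exists>G. \<forall>k. finite (G k) \<and> card (G k) \<le> A * 2 powr (real k * p) \<and>
      (\<forall>a\<in>K. \<exists>v\<in>cspan (G k). norm (a - v) \<le> \<delta> / 2 ^ 2 ^ (k + 2))"
  shows "\<exists>\<delta>>0. \<exists>H\<ge>0. \<forall>n. \<exists>S. finite S \<and> card S \<le> exp (H * 2 powr (real n * p)) \<and>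
    (\<forall>a\<in>K \<inter> ball x0 \<delta>. \<exists>v\<in>cspan S. norm (u a - v) \<le> 2 * 2 powr (- (2 powr (real n * (1 + p)))))"
proof -
  obtain \<rho> A where rho: "\<rho> > 0" and A: "\<And>m. m \<ge> 1 \<Longrightarrow> multilinear_map m (A m)"
    "\<And>m z. m \<ge> 1 \<Longrightarrow> norm z < \<rho> \<Longrightarrow> norm (A m (replicate m z)) \<le> (1 / 2) ^ m"
    "\<And>z. norm z < \<rho> \<Longrightarrow> (\<lambda>N. u x0 + (\<Sum>m=1..N. A m (replicate m z))) \<longlonglongrightarrow> u (x0 + z)"
    by (rule banach_holomorphic_on_expansion[OF assms(1,2)]) (rule that)
  define \<delta> where "\<delta> = \<rho> / 5"
  have delta: "\<delta> > 0" "5 * \<delta> = \<rho>" using rho by (auto simp: \<delta>_def)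
  obtain A0 G where A0: "A0 \<ge> 0" and G: "\<And>k. finite (G k)" "\<And>k. card (G k) \<le> A0 * 2 powr (real k * p)"
    "\<And>k a. a \<in> K \<Longrightarrow> \<exists>v\<in>cspan (G k). norm (a - v) \<le> \<delta> / 2 ^ 2 ^ (k + 2)"
    using G[OF delta(1)] by metis
  define B where "B = case_nat (insert x0 (G 0)) (\<lambda>j. G j \<union> G (Suc j))"
  have finB: "finite (B k)" for k unfolding B_def using G(1) by (cases k) auto
  \<comment> \<open>The point \<open>x0\<close> adds one vector at level 0, and joining two levels
    doubles the count elsewhere: hence \<open>2 * A0 + 1\<close>.\<close>
  have cardB: "card (B k) \<le> (2 * A0 + 1) * 2 powr (real k * p)" for k
  proof (cases k)
    case 0
    have "real (card (B 0)) \<le> 1 + real (card (G 0))"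
      using card_insert_le_m1[of "Suc (card (G 0))" "G 0" x0] by (simp add: B_def)
    then show ?thesis using G(2)[of 0] A0 0 by simp
  next
    case (Suc j)
    have "real (card (B k)) \<le> real (card (G j)) + real (card (G k))"
      using card_Un_le[of "G j" "G k"] Suc by (simp add: B_def)
    also have "\<dots> \<le> A0 * 2 powr (real j * p) + A0 * 2 powr (real k * p)"
      using G(2)[of j] G(2)[of k] by simp
    also have "A0 * 2 powr (real j * p) \<le> A0 * 2 powr (real k * p)"
      using Suc \<open>p > 0\<close> A0 by (intro mult_left_mono powr_mono) auto
    finally have "real (card (B k)) \<le> 2 * A0 * 2 powr (real k * p)" by simp
    also have "\<dots> \<le> (2 * A0 + 1) * 2 powr (real k * p)" by (intro mult_right_mono) auto
    finally show ?thesis .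
  qed
  obtain H where H: "H \<ge> 0"
    "\<forall>(B :: nat \<Rightarrow> 'x set) K. (\<forall>k. finite (B k) \<and> card (B k) \<le> (2 * A0 + 1) * 2 powr (real k * p)) \<longrightarrow>
      (let M = weighted_multisets (\<lambda>i. 2 ^ fst i) (Sigma {..nat \<lceil>2 powr (real K * (1 + p))\<rceil>} B)
         (nat \<lceil>2 powr (real K * (1 + p))\<rceil>)
       in finite M \<and> card M \<le> exp (H * 2 powr (real K * p)))"
    using card_dyadic_multisets[of p "2 * A0 + 1", where 'b = 'x] \<open>p > 0\<close> A0 by auto
  have "\<exists>S. finite S \<and> card S \<le> exp (H * 2 powr (real n * p)) \<and>
    (\<forall>a\<in>K \<inter> ball x0 \<delta>. \<exists>v\<in>cspan S. norm (u a - v) \<le> 2 * 2 powr (- (2 powr (real n * (1 + p)))))" for n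
  proof -
    define L where "L = nat \<lceil>2 powr (real n * (1 + p))\<rceil>"
    define M where "M = weighted_multisets (\<lambda>i. 2 ^ fst i) (Sigma {..L} B) L"
    define E where "E = (\<lambda>\<nu> :: (nat \<times> 'x) multiset. if \<nu> = {#} then u x0 else \<Sum>\<kappa> | mset \<kappa> = \<nu>. A (size \<nu>) (map snd \<kappa>))"
    have M: "finite M" "card M \<le> exp (H * 2 powr (real n * p))"
      using H(2)[rule_format, of B n] finB cardB unfolding M_def L_def Let_def by auto
    have "\<exists>v\<in>cspan (E ` M). norm (u a - v) \<le> 2 * 2 powr (- (2 powr (real n * (1 + p))))"
      if a: "a \<in> K" "a \<in> ball x0 \<delta>" for a
    proof -
      have ax: "norm (a - x0) < \<delta>" using a(2) by (simp add: dist_norm norm_minus_commute)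
      obtain I c where I: "finite I" "\<And>i. i \<in> I \<Longrightarrow> 2 ^ fst i \<le> L \<Longrightarrow> i \<in> Sigma {..L} B"
        "a - x0 = (\<Sum>i\<in>I. c i *\<^sub>C snd i)"
        "\<And>t. cmod t = 2 \<Longrightarrow> norm (\<Sum>i\<in>I. (t ^ 2 ^ fst i * c i) *\<^sub>C snd i) < 5 * \<delta>"
        using dyadic_decomposition[OF G(1) G(3)[OF a(1)] ax, of L] unfolding B_def by blast
      have "\<exists>v\<in>cspan (E ` M). norm (u (x0 + (a - x0)) - v) \<le> 2 / 2 ^ L"
        unfolding E_def M_def
        by (rule weighted_approximation[where \<rho> = \<rho> and f = "\<lambda>z. u (x0 + z)", OF A I(1,2,3)])
           (use I(4) ax delta in auto)
      then obtain v where v: "v \<in> cspan (E ` M)" "norm (u a - v) \<le> 2 / 2 ^ L" by auto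
      have "2 powr (real n * (1 + p)) \<le> real L" unfolding L_def by linarith
      then have "2 powr (- real L) \<le> 2 powr (- (2 powr (real n * (1 + p))))" by simp
      then have "2 / 2 ^ L \<le> 2 * 2 powr (- (2 powr (real n * (1 + p))))"
        by (simp add: powr_minus powr_realpow divide_inverse)
      then show ?thesis using v by (intro bexI[of _ v]) auto
    qed
    moreover have "card (E ` M) \<le> exp (H * 2 powr (real n * p))"
      using M card_image_le[OF M(1), of E] by linarith
    ultimately show ?thesis using M(1) by (intro exI[of _ "E ` M"]) auto
  qed
  then show ?thesis using delta(1) H(1) by blast
qed

section \<open>Kolmogorov widths\<close>

text \<open>\<open>cdim_le\<close> asks for a basis, so \<open>S\<close> is thinned to a maximal
  independent subset with the same span.\<close>

lemma kolmogorov_width_le: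
  fixes A :: "'a::complex_normed_vector set"
  assumes "finite S" "card S \<le> n" "\<And>a. a \<in> A \<Longrightarrow> \<exists>v\<in>cspan S. norm (a - v) \<le> e"
  shows "kolmogorov_width n A \<le> ennreal e"
proof -
  obtain B where B: "B \<subseteq> S" "\<not> cdependent B" "S \<subseteq> cspan B"
    using complex_vector.maximal_independent_subset[of S] by metis
  have "cspan B = cspan S"
    using B by (meson complex_vector.span_mono complex_vector.span_minimal complex_vector.subspace_span subset_antisym)
  moreover have "finite B" "card B \<le> n"
    using B assms by (auto intro: finite_subset order_trans[OF card_mono])
  ultimately have "cdim_le (cspan S) n" unfolding cdim_le_def using B by blast
  then have "kolmogorov_width n A \<le> (SUP a\<in>A. INF v\<in>cspan S. ennreal (norm (a - v)))"
    unfolding kolmogorov_width_def by (intro INF_lower) (auto simp: complex_vector.subspace_span)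
  also have "\<dots> \<le> ennreal e"
  proof (intro SUP_least)
    fix a assume "a \<in> A"
    then obtain v where "v \<in> cspan S" "norm (a - v) \<le> e" using assms by blast
    then show "(INF v\<in>cspan S. ennreal (norm (a - v))) \<le> ennreal e"
      by (intro INF_lower2[of v] ennreal_leI)
  qed
  finally show ?thesis .
qed

text \<open>Strictness is what yields an actual \<open>V\<close> and \<open>v\<close>, as neither
  infimum need be attained.\<close>

lemma kolmogorov_width_lessD:
  fixes A :: "'a::complex_normed_vector set"
  assumes "kolmogorov_width n A < ennreal e"
  obtains S where "finite S" "card S \<le> n" "\<And>a. a \<in> A \<Longrightarrow> \<exists>v\<in>cspan S. norm (a - v) \<le> e"
proof -
  obtain V where V: "cdim_le V n" "(SUP a\<in>A. INF v\<in>V. ennreal (norm (a - v))) < ennreal e"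
    using assms unfolding kolmogorov_width_def INF_less_iff by auto
  then obtain S where S: "finite S" "cspan S = V" "card S \<le> n"
    unfolding cdim_le_def by auto
  show ?thesis
  proof (rule that[OF S(1) S(3)])
    fix a assume "a \<in> A"
    then have "(INF v\<in>V. ennreal (norm (a - v))) < ennreal e"
      using V(2) by (meson SUP_upper le_less_trans)
    then obtain v where "v \<in> V" "ennreal (norm (a - v)) < ennreal e"
      unfolding INF_less_iff by auto
    then show "\<exists>v\<in>cspan S. norm (a - v) \<le> e"
      unfolding S(2) by (intro bexI[of _ v]) (auto simp: ennreal_less_iff)
  qed
qed

text \<open>At level \<open>k\<close> the width is used with \<open>n\<close> about
  \<open>(g * 2 ^ k) powr (1 / \<alpha>)\<close>. Then \<open>n powr \<alpha>\<close> is at least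
  \<open>g * 2 ^ k\<close>, enough for doubly exponential accuracy, while the dimension has order
  only \<open>2 powr (k / \<alpha>)\<close>.\<close>

lemma dyadic_spans_of_width:
  fixes K :: "'a::complex_normed_vector set" and \<alpha> C\<^sub>0 c\<^sub>0 \<delta> :: real
  assumes pos: "C\<^sub>0 > 0" "c\<^sub>0 > 0" "\<alpha> > 0" "\<delta> > 0"
    and width: "\<forall>n\<ge>1. kolmogorov_width n K \<le> ennreal (C\<^sub>0 * exp (- c\<^sub>0 * real n powr \<alpha>))"
  shows "\<exists>A\<ge>0. \<exists>G. \<forall>k. finite (G k) \<and> card (G k) \<le> A * 2 powr (real k * (1 / \<alpha>)) \<and>
    (\<forall>a\<in>K. \<exists>v\<in>cspan (G k). norm (a - v) \<le> \<delta> / 2 ^ 2 ^ (k + 2))"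
proof -
  define p where "p = 1 / \<alpha>"
  have p: "p > 0" "p * \<alpha> = 1" using pos by (auto simp: p_def)
  \<comment> \<open>The 4 covers \<open>2 ^ (k + 2) * ln 2\<close>, as \<open>ln 2 < 1\<close>. The
    logarithm absorbs the prefactor \<open>C\<^sub>0\<close> and the scale \<open>\<delta>\<close>;
    its 2 leaves room for the strict inequality in \<open>kolmogorov_width_lessD\<close>.\<close>
  define g where "g = (\<bar>ln (2 * C\<^sub>0 / \<delta>)\<bar> + 4) / c\<^sub>0"
  have g: "g > 0" "c\<^sub>0 * g = \<bar>ln (2 * C\<^sub>0 / \<delta>)\<bar> + 4" using pos by (auto simp: g_def)
  have "\<exists>S. finite S \<and> card S \<le> (g powr p + 1) * 2 powr (real k * p) \<and>
    (\<forall>a\<in>K. \<exists>v\<in>cspan S. norm (a - v) \<le> \<delta> / 2 ^ 2 ^ (k + 2))" for k :: nat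
  proof -
    define n where "n = nat \<lceil>(g * 2 ^ k) powr p\<rceil>"
    have gk: "(g * 2 ^ k) powr p > 0" using g by simp
    have n: "n \<ge> 1" "(g * 2 ^ k) powr p \<le> real n" "real n \<le> (g * 2 ^ k) powr p + 1"
      unfolding n_def using gk by linarith+
    have "g * 2 ^ k = ((g * 2 ^ k) powr p) powr \<alpha>" using g p by (simp add: powr_powr)
    also have "\<dots> \<le> real n powr \<alpha>" using n gk pos by (intro powr_mono2) auto
    finally have "c\<^sub>0 * (g * 2 ^ k) \<le> c\<^sub>0 * real n powr \<alpha>" using pos by simp
    moreover have "c\<^sub>0 * (g * 2 ^ k) = \<bar>ln (2 * C\<^sub>0 / \<delta>)\<bar> * 2 ^ k + 4 * 2 ^ k"
      unfolding mult.assoc[symmetric] g(2) by (rule distrib_right)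
    moreover have "\<bar>ln (2 * C\<^sub>0 / \<delta>)\<bar> * 1 \<le> \<bar>ln (2 * C\<^sub>0 / \<delta>)\<bar> * 2 ^ k"
      by (intro mult_left_mono) auto
    moreover have "(4 * 2 ^ k) * ln 2 \<le> (4 * 2 ^ k) * (1::real)"
      using ln_2_less_1 by (intro mult_left_mono) auto
    ultimately have "ln (2 * C\<^sub>0 / \<delta>) + (4 * 2 ^ k) * ln 2 \<le> c\<^sub>0 * real n powr \<alpha>"
      by linarith
    then have "exp (- c\<^sub>0 * real n powr \<alpha>) \<le> exp (- (ln (2 * C\<^sub>0 / \<delta>)) - (4 * 2 ^ k) * ln 2)"
      by simp
    also have "\<dots> = (\<delta> / (2 * C\<^sub>0)) / exp ((4 * 2 ^ k) * ln 2)"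
      using pos by (simp add: exp_diff exp_minus)
    also have "exp ((4 * 2 ^ k) * ln 2) = (2::real) ^ 2 ^ (k + 2)"
      using exp_of_nat_mult[of "2 ^ (k + 2)" "ln 2 :: real"] by (simp add: power_add)
    finally have e: "2 * (C\<^sub>0 * exp (- c\<^sub>0 * real n powr \<alpha>)) \<le> \<delta> / 2 ^ 2 ^ (k + 2)"
      using pos by (simp add: field_simps)
    let ?e = "C\<^sub>0 * exp (- c\<^sub>0 * real n powr \<alpha>)"
    have "kolmogorov_width n K \<le> ennreal ?e" using width n(1) by blast
    also have "ennreal ?e < ennreal (2 * ?e)" using pos by (intro ennreal_lessI) auto
    finally have "kolmogorov_width n K < ennreal (2 * ?e)" .
    then obtain S where S: "finite S" "card S \<le> n" "\<And>a. a \<in> K \<Longrightarrow> \<exists>v\<in>cspan S. norm (a - v) \<le> 2 * ?e"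
      by (rule kolmogorov_width_lessD) (rule that)
    have "(g * 2 ^ k) powr p = g powr p * 2 powr (real k * p)"
      using g by (simp add: powr_mult powr_powr flip: powr_realpow)
    moreover have "1 \<le> 2 powr (real k * p)" using p by (simp add: ge_one_powr_ge_zero)
    ultimately have "real (card S) \<le> (g powr p + 1) * 2 powr (real k * p)"
      using n(3) S(2) by (simp add: algebra_simps)
    moreover have "\<exists>v\<in>cspan S. norm (a - v) \<le> \<delta> / 2 ^ 2 ^ (k + 2)" if "a \<in> K" for a
      using S(3)[OF that] e by (meson order_trans)
    ultimately show ?thesis using S(1) by blast
  qed
  then have "\<exists>G. \<forall>k. finite (G k) \<and> card (G k) \<le> (g powr p + 1) * 2 powr (real k * p) \<and>
    (\<forall>a\<in>K. \<exists>v\<in>cspan (G k). norm (a - v) \<le> \<delta> / 2 ^ 2 ^ (k + 2))"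
    by (intro choice) blast
  then show ?thesis unfolding p_def by (intro exI[of _ "g powr p + 1"]) (auto simp: p_def)
qed

text \<open>The radii do not depend on \<open>n\<close>, so a finite subcover is fixed before
  \<open>n\<close>. Uniting the local spanning sets costs a factor equal to the number of balls,
  absorbed in the exponent because \<open>2 powr (real n * p) \<ge> 1\<close>.\<close>

lemma compact_span_approximation:
  fixes u :: "'x::complex_normed_vector \<Rightarrow> 'y::complex_normed_vector" and p :: real
  assumes "compact K" "p > 0"
    and loc: "\<And>x0. x0 \<in> K \<Longrightarrow> \<exists>\<delta>>0. \<exists>H\<ge>0. \<forall>n. \<exists>S. finite S \<and> card S \<le> exp (H * 2 powr (real n * p)) \<and>
      (\<forall>a\<in>K \<inter> ball x0 \<delta>. \<exists>v\<in>cspan S. norm (u a - v) \<le> \<epsilon> n)"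
  obtains H where "H \<ge> 1" "\<And>n. \<exists>S. finite S \<and> card S \<le> exp (H * 2 powr (real n * p)) \<and>
    (\<forall>a\<in>K. \<exists>v\<in>cspan S. norm (u a - v) \<le> \<epsilon> n)"
proof -
  obtain \<delta> H where dH: "\<And>x. x \<in> K \<Longrightarrow> \<delta> x > 0" "\<And>x. x \<in> K \<Longrightarrow> H x \<ge> (0::real)"
    "\<And>x n. x \<in> K \<Longrightarrow> \<exists>S. finite S \<and> card S \<le> exp (H x * 2 powr (real n * p)) \<and>
      (\<forall>a\<in>K \<inter> ball x (\<delta> x). \<exists>v\<in>cspan S. norm (u a - v) \<le> \<epsilon> n)"
    using loc by metis
  obtain S where S: "\<And>x n. x \<in> K \<Longrightarrow> finite (S x n)"
    "\<And>x n. x \<in> K \<Longrightarrow> card (S x n) \<le> exp (H x * 2 powr (real n * p))"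
    "\<And>x n a. x \<in> K \<Longrightarrow> a \<in> K \<inter> ball x (\<delta> x) \<Longrightarrow> \<exists>v\<in>cspan (S x n). norm (u a - v) \<le> \<epsilon> n"
    using dH(3) by metis
  have cover: "K \<subseteq> (\<Union>x\<in>K. ball x (\<delta> x))" using dH(1) by force
  obtain F where F: "F \<subseteq> K" "finite F" "K \<subseteq> (\<Union>x\<in>F. ball x (\<delta> x))"
    by (rule compactE_image[OF assms(1) open_ball cover]) (rule that)
  \<comment> \<open>A sum, not a maximum, so that an empty cover needs no separate
    treatment.\<close>
  define H' where "H' = (\<Sum>x\<in>F. H x)"
  have H': "H x \<le> H'" if "x \<in> F" for x
    unfolding H'_def using F dH(2) that by (intro member_le_sum) auto
  have H'0: "H' \<ge> 0" unfolding H'_def using F dH(2) by (intro sum_nonneg) auto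
  show ?thesis
  proof (rule that[of "1 + real (card F) + H'"])
    show "1 + real (card F) + H' \<ge> 1" using H'0 by simp
    fix n :: nat
    define z where "z = 2 powr (real n * p)"
    have z: "z \<ge> 1" unfolding z_def using \<open>p > 0\<close> by (simp add: ge_one_powr_ge_zero)
    let ?S = "\<Union>x\<in>F. S x n"
    have "real (card ?S) \<le> (\<Sum>x\<in>F. real (card (S x n)))"
      using card_UN_le[OF F(2), of "\<lambda>x. S x n"] by (simp flip: of_nat_sum)
    also have "\<dots> \<le> (\<Sum>x\<in>F. exp (H' * z))"
    proof (intro sum_mono)
      fix x assume "x \<in> F"
      then show "real (card (S x n)) \<le> exp (H' * z)"
        using S(2)[of x n] F(1) H'[of x] z unfolding z_def
        by (intro order_trans[OF S(2)]) (auto intro: mult_right_mono)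
    qed
    also have "\<dots> = real (card F) * exp (H' * z)" by simp
    also have "\<dots> \<le> exp ((1 + real (card F)) * z) * exp (H' * z)"
    proof (intro mult_right_mono)
      have "real (card F) \<le> 1 + real (card F) * z"
        using mult_left_mono[OF z, of "real (card F)"] by simp
      also have "\<dots> \<le> exp (real (card F) * z)" by (rule exp_ge_add_one_self)
      also have "\<dots> \<le> exp ((1 + real (card F)) * z)" using z by (simp add: distrib_right)
      finally show "real (card F) \<le> exp ((1 + real (card F)) * z)" .
    qed auto
    also have "\<dots> = exp ((1 + real (card F) + H') * z)"
      by (simp add: algebra_simps flip: exp_add)
    finally have c: "card ?S \<le> exp ((1 + real (card F) + H') * z)" .
    have "\<exists>v\<in>cspan ?S. norm (u a - v) \<le> \<epsilon> n" if "a \<in> K" for a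
    proof -
      obtain x where x: "x \<in> F" "a \<in> ball x (\<delta> x)" using F(3) \<open>a \<in> K\<close> by blast
      then obtain v where "v \<in> cspan (S x n)" "norm (u a - v) \<le> \<epsilon> n" using S(3)[of x a n] F(1) \<open>a \<in> K\<close> by blast
      moreover have "cspan (S x n) \<subseteq> cspan ?S" using x by (intro complex_vector.span_mono) auto
      ultimately show ?thesis by blast
    qed
    moreover have "finite ?S" using F S(1) by auto
    ultimately show "\<exists>S. finite S \<and> card S \<le> exp ((1 + real (card F) + H') * 2 powr (real n * p)) \<and>
        (\<forall>a\<in>K. \<exists>v\<in>cspan S. norm (u a - v) \<le> \<epsilon> n)"
      using c unfolding z_def by (intro exI[of _ ?S]) auto
  qed
qed

section \<open>Passage from the dyadic scales to every dimension \<open>n\<close>\<close>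

theorem theorem1p4:
  fixes u :: "'x :: complex_banach \<Rightarrow> 'y :: complex_banach"
    and U K :: "'x set"
    and C C\<^sub>0 c\<^sub>0 \<alpha> :: real
  assumes "open U"
    and "compact K"
    and "K \<subseteq> U"
    and "banach_holomorphic_on u U"
    and "\<forall>a\<in>U. norm (u a) \<le> C"
    and "C\<^sub>0 > 0" "c\<^sub>0 > 0" "\<alpha> > 0"
    and "\<forall>n\<ge>1. kolmogorov_width n K \<le> ennreal (C\<^sub>0 * exp (- c\<^sub>0 * real n powr \<alpha>))"
  shows "\<exists>C\<^sub>1>0. \<exists>c\<^sub>1>0. \<forall>n\<ge>1.
    kolmogorov_width n (u ` K) \<le> ennreal (C\<^sub>1 * exp (- c\<^sub>1 * ln (real n + 2) powr (\<alpha> + 1)))"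
proof -
  define p where "p = 1 / \<alpha>"
  have p: "p > 0" "p * \<alpha> = 1" using \<open>\<alpha> > 0\<close> by (auto simp: p_def)
  define \<epsilon> where "\<epsilon> n = 2 * 2 powr (- (2 powr (real n * (1 + p))))" for n :: nat
  have loc: "\<exists>\<delta>>0. \<exists>H\<ge>0. \<forall>n. \<exists>S. finite S \<and> card S \<le> exp (H * 2 powr (real n * p)) \<and>
      (\<forall>a\<in>K \<inter> ball x0 \<delta>. \<exists>v\<in>cspan S. norm (u a - v) \<le> \<epsilon> n)" if "x0 \<in> K" for x0
    unfolding \<epsilon>_def
  proof (rule local_span_approximation[OF assms(4) _ p(1)])
    show "x0 \<in> U" using that assms(3) by auto
    show "\<exists>A\<ge>0. \<exists>G. \<forall>k. finite (G k) \<and> card (G k) \<le> A * 2 powr (real k * p) \<and>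
      (\<forall>a\<in>K. \<exists>v\<in>cspan (G k). norm (a - v) \<le> \<delta> / 2 ^ 2 ^ (k + 2))" if "\<delta> > 0" for \<delta>
      unfolding p_def by (rule dyadic_spans_of_width[OF assms(6-8) that assms(9)])
  qed
  obtain H where H: "H \<ge> 1" "\<And>n. \<exists>S. finite S \<and> card S \<le> exp (H * 2 powr (real n * p)) \<and>
      (\<forall>a\<in>K. \<exists>v\<in>cspan S. norm (u a - v) \<le> \<epsilon> n)"
    by (rule compact_span_approximation[OF assms(2) p(1) loc]) (assumption, rule that)
  \<comment> \<open>The base \<open>1 / (2 * H)\<close> combines
    \<open>ln (real n + 2) \<le> 2 * ln (real n)\<close> with the factor \<open>H\<close> in the
    size of the spanning sets; \<open>2 powr (- (1 + p))\<close> is the loss from rounding the scale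
    \<open>k\<close> down.\<close>
  define \<kappa> where "\<kappa> = 2 powr (- (1 + p)) * (1 / (2 * H)) powr (\<alpha> + 1)"
  define c1 where "c1 = ln 2 * \<kappa>"
  have c1: "c1 > 0" using H(1) by (simp add: c1_def \<kappa>_def)
  \<comment> \<open>The 2 is the factor in \<open>\<epsilon>\<close>; the other summand handles
    small \<open>n\<close>. The absolute value gives \<open>C1 > 0\<close> even if \<open>U\<close>
    is empty and \<open>C\<close> negative.\<close>
  define C1 where "C1 = 2 + \<bar>C\<bar> * exp (c1 * (H + 2) powr (\<alpha> + 1))"
  have "kolmogorov_width n (u ` K) \<le> ennreal (C1 * exp (- c1 * ln (real n + 2) powr (\<alpha> + 1)))" (is "_ \<le> ennreal ?b")
    if n: "n \<ge> 1" for n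
  proof (cases "ln (real n) < H")
    \<comment> \<open>Here even scale 0 may need more than \<open>n\<close> vectors, so the zero
      subspace and the bound on \<open>u\<close> are used.\<close>
    case True
    have "ln (real n + 2) \<le> ln (3 * real n)" using n by (intro ln_mono) auto
    also have "\<dots> = ln 3 + ln (real n)" using n by (simp add: ln_mult)
    also have "ln (3::real) \<le> 2" using ln_le_minus_one[of "3::real"] by simp
    finally have "ln (real n + 2) \<le> H + 2" using True by simp
    then have "ln (real n + 2) powr (\<alpha> + 1) \<le> (H + 2) powr (\<alpha> + 1)"
      using assms(8) by (intro powr_mono2) auto
    then have "1 \<le> exp (c1 * (H + 2) powr (\<alpha> + 1)) * exp (- c1 * ln (real n + 2) powr (\<alpha> + 1))"
      using c1 by (simp flip: exp_add)
    then have "\<bar>C\<bar> * 1 \<le> \<bar>C\<bar> * (exp (c1 * (H + 2) powr (\<alpha> + 1)) * exp (- c1 * ln (real n + 2) powr (\<alpha> + 1)))"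
      by (intro mult_left_mono) auto
    also have "\<dots> \<le> ?b" by (simp add: C1_def distrib_right mult.assoc)
    finally have b: "\<bar>C\<bar> \<le> ?b" by simp
    show ?thesis
    proof (rule kolmogorov_width_le[of "{}"])
      fix y assume "y \<in> u ` K"
      then have "norm y \<le> \<bar>C\<bar>" using assms(3,5) by (force intro: order_trans[OF _ abs_ge_self])
      then show "\<exists>v\<in>cspan {}. norm (y - v) \<le> ?b" using b by simp
    qed auto
  next
    case False
    define y where "y = ln (real n) / H"
    have y: "y \<ge> 1" "H * y = ln (real n)" using False H(1) by (auto simp: y_def)
    \<comment> \<open>As \<open>ln 1 = 0 < H\<close>, the case \<open>n = 1\<close> is excluded, and
      \<open>n \<ge> 2\<close> gives \<open>n + 2 \<le> n * n\<close> below.\<close>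
    have "n \<noteq> 1" using False H(1) by auto
    then have n2: "n \<ge> 2" using n by simp
    \<comment> \<open>The largest scale with
      \<open>H * 2 powr (real k * p) \<le> ln (real n)\<close>, that is, whose spanning set surely
      fits into dimension \<open>n\<close>.\<close>
    define k where "k = nat \<lfloor>log 2 y / p\<rfloor>"
    have "log 2 y / p \<ge> 0" using y p by simp
    then have k: "real k \<le> log 2 y / p" "log 2 y / p \<le> real k + 1" unfolding k_def by linarith+
    have k1: "real k * p \<le> log 2 y" "log 2 y \<le> (real k + 1) * p"
      using k p by (simp_all add: field_simps)
    have "2 powr (real k * p) \<le> 2 powr log 2 y" using k1 by simp
    then have ky: "2 powr (real k * p) \<le> y" using y by simp
    have "2 powr log 2 y \<le> 2 powr ((real k + 1) * p)" using k1 by simp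
    then have yk: "y \<le> 2 powr ((real k + 1) * p)" using y by simp
    obtain S where S: "finite S" "card S \<le> exp (H * 2 powr (real k * p))"
      "\<And>a. a \<in> K \<Longrightarrow> \<exists>v\<in>cspan S. norm (u a - v) \<le> \<epsilon> k"
      using H(2)[of k] by blast
    have "H * 2 powr (real k * p) \<le> ln (real n)"
      unfolding y(2)[symmetric] using ky H(1) by (intro mult_left_mono) auto
    then have "exp (H * 2 powr (real k * p)) \<le> real n"
      using n by (metis exp_le_cancel_iff exp_ln less_le_trans of_nat_0_less_iff zero_less_one)
    then have cardS: "card S \<le> n" using S(2) by linarith
    have "real n + 2 \<le> real n * real n"
    proof -
      have "real n \<ge> 2" using n2 by simp
      moreover from this have "real n * 2 \<le> real n * real n" by (intro mult_left_mono) auto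
      ultimately show ?thesis by linarith
    qed
    then have "ln (real n + 2) \<le> ln (real n * real n)" using n by (intro ln_mono) auto
    also have "\<dots> = 2 * ln (real n)" using n by (simp add: ln_mult)
    finally have "1 / (2 * H) * ln (real n + 2) \<le> y"
      using H(1) by (simp add: y_def field_simps)
    then have "(1 / (2 * H) * ln (real n + 2)) powr (\<alpha> + 1) \<le> y powr (\<alpha> + 1)"
      using H(1) assms(8) by (intro powr_mono2) auto
    also have "\<dots> \<le> (2 powr ((real k + 1) * p)) powr (\<alpha> + 1)"
      using yk y assms(8) by (intro powr_mono2) auto
    \<comment> \<open>From \<open>p * \<alpha> = 1\<close> follows
      \<open>p * (\<alpha> + 1) = 1 + p\<close>, which matches the power \<open>\<alpha> + 1\<close>
      of the logarithm with the exponent in \<open>\<epsilon>\<close>.\<close>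
    also have "\<dots> = 2 powr ((real k + 1) * (1 + p))"
    proof -
      have "(real k + 1) * p * (\<alpha> + 1) = (real k + 1) * (p * \<alpha> + p)" by (simp add: algebra_simps)
      then show ?thesis by (simp only: powr_powr p(2))
    qed
    also have "\<dots> = 2 powr (real k * (1 + p)) * 2 powr (1 + p)"
      by (subst powr_add[symmetric]) (simp add: algebra_simps)
    finally have "(1 / (2 * H)) powr (\<alpha> + 1) * ln (real n + 2) powr (\<alpha> + 1)
        \<le> 2 powr (real k * (1 + p)) * 2 powr (1 + p)"
      using H(1) by (subst powr_mult[symmetric]) auto
    then have "2 powr (- (1 + p)) * ((1 / (2 * H)) powr (\<alpha> + 1) * ln (real n + 2) powr (\<alpha> + 1))
        \<le> 2 powr (- (1 + p)) * (2 powr (real k * (1 + p)) * 2 powr (1 + p))"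
      by (intro mult_left_mono) auto
    moreover have "2 powr (- (1 + p)) * (2 powr (real k * (1 + p)) * 2 powr (1 + p)) = 2 powr (real k * (1 + p))"
      by (simp only: powr_add[symmetric]) simp
    ultimately have "\<kappa> * ln (real n + 2) powr (\<alpha> + 1) \<le> 2 powr (real k * (1 + p))"
      unfolding \<kappa>_def mult.assoc by (simp only:)
    then have "c1 * ln (real n + 2) powr (\<alpha> + 1) \<le> ln 2 * 2 powr (real k * (1 + p))"
      unfolding c1_def mult.assoc by (intro mult_left_mono) auto
    then have "\<epsilon> k \<le> 2 * exp (- c1 * ln (real n + 2) powr (\<alpha> + 1))"
      unfolding \<epsilon>_def by (subst powr_def) (simp add: mult.commute)
    also have "\<dots> \<le> ?b" by (intro mult_right_mono) (auto simp: C1_def)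
    finally have "\<epsilon> k \<le> ?b" .
    then have "\<exists>v\<in>cspan S. norm (u a - v) \<le> ?b" if "a \<in> K" for a
      using S(3)[OF that] by (meson order_trans)
    then show ?thesis by (intro kolmogorov_width_le[OF S(1) cardS]) blast
  qed
  moreover have "C1 > 0" by (simp add: C1_def add_pos_nonneg)
  ultimately show ?thesis using c1 by blast
qed

end
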